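(* Let $\mathcal{D}$ be a circular billiard table of radius $R>0$, let $\varepsilon>0$, let $\nu_\varepsilon=\rho\,d\mathbf{m}$ be any noise distribution on $\mathbb{R}^2$ whose density $\rho$ has support containing the ball $B_\varepsilon(0,0)$, and let $P$ be the Markov transition function on the collision space $M$ obtained by applying the billiard map $F$ of $\mathcal{D}$ and then the random perturbation with law $\nu_\varepsilon$. Then the resulting random billiard is ergodic, i.e. the probability measure $m$ with $dm=\frac{1}{2|\partial\mathcal{D}|}\,dr\,ds$ is ergodic with respect to $P$, but the Lyapunov exponents $\lambda_1\ge\lambda_2$ associated to the derivative map $DF$ along the Markov process with transition function $P$ and initial distribution $m$ are always $0$: $\lambda_1=\lambda_2=0$.
   Context: Billiard map. The boundary $\partial\mathcal{D}$ is a circle of length $L=|\partial\mathcal{D}|=2\pi R$, parametrized by arclength $r\in[0,L]$ with the interior $\mathcal{D}_0$ on its left. A point particle moves in $\mathcal{D}_0$ with constant velocity and reflects at the boundary by $v^+=v^--2(v^-,n)n$, $n$ the inward unit normal. A collision is described by $(r,s)$, where $r$ is the arclength parameter of the collision point and $s=\sin\varphi$, with $\varphi\in[-\pi/2,\pi/2]$ the signed angle from the post-collisional velocity $v$ to $n$. The collision space $M$ is the cylinder obtained from $[0,L]\times[-1,1]$ by identifying the edges $\{r=0\}$ and $\{r=L\}$, with Borel $\sigma$-algebra $\mathcal{B}$, and $F:M\to M$ is the billiard map sending a collision $(r,s)$ to the next collision $(r_1,s_1)$. It preserves the probability measure $dm=\frac{1}{2|\partial\mathcal{D}|}\,dr\,ds$.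 $DF(x)$ denotes the $2\times2$ Jacobian matrix of $F$ at $x$ in the coordinates $(r,s)$; it is defined for $m$-a.e. $x$ and has determinant $1$. Random perturbation. Fix $\varepsilon>0$ and a probability measure $\nu_\varepsilon$ on $\mathbb{R}^2$ with $d\nu_\varepsilon=\rho\,d\mathbf{m}$, $\mathbf{m}$ Lebesgue measure, where $\rho$ is measurable and its support contains the ball $B_\varepsilon(0,0)$ of radius $\varepsilon$ about the origin, meaning that $\rho$ is positive on this ball. Let $\Lambda=L\mathbb{Z}\times 2\mathbb{Z}$. For $x\in M$ and $B\in\mathcal{B}$ put $\eta_\varepsilon^x(B)=\nu_\varepsilon\{u\in\mathbb{R}^2: u+x\in B \bmod \Lambda\}=\int_B\sum_{v\in\Lambda}\rho(u-x-v)\,\mathbf{m}(du)$. The Markov transition function is $P(x,B)=\eta_\varepsilon^{F(x)}(B)$ for $m$-a.e. $x\in M$ and $B\in\mathcal{B}$. The measure $m$ is invariant with respect to $P$, i.e. $m(B)=\int_M P(x,B)\,m(dx)$ for all $B\in\mathcal{B}$. Ergodicity. Let $\Omega$ be the space of sequences $\omega=(x_0,x_1,\dots)$ in $M$ with product $\sigma$-algebra $\mathcal{A}$, shift $\theta(x_0,x_1,\dots)=(x_1,x_2,\dots)$, and let $\mathbf{P}_m$ be the law on $\Omega$ of the Markov process with transition function $P$ and initial distribution $m$. The measure $m$ is ergodic with respect to $P$ if $A\in\mathcal{A}$, $\theta^{-1}(A)=A$ implies $\mathbf{P}_m(A)\in\{0,1\}$. Lyapunov exponents. Put $A^{(n)}(\omega)=DF(x_{n-1})DF(x_{n-2})\cdots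 DF(x_0)$ for $n\ge1$. The Lyapunov exponents $\lambda_1\ge\lambda_2$ are defined by $\lambda_1=\lim_{n\to\infty}\frac1n\int_\Omega\log\|A^{(n)}(\omega)\|\,\mathbf{P}_m(d\omega)$ and $\lambda_1+\lambda_2=\lim_{n\to\infty}\frac1n\int_\Omega\log|\det A^{(n)}(\omega)|\,\mathbf{P}_m(d\omega)$, where $\|\cdot\|$ is the operator norm. *)

theory Defs
  imports "HOL-Probability.Probability"
begin

section \<open>The circular billiard\<close>

text \<open>The table is the disc of radius \<open>R\<close> centred at the origin of the plane \<open>complex\<close>. Its
  boundary is parametrized counterclockwise by arclength, so that the interior is on the left.\<close>

definition perimeter :: "real \<Rightarrow> real" where
  "perimeter R = 2 * pi * R"

definition bdry :: "real \<Rightarrow> real \<Rightarrow> complex" where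
  "bdry R r = of_real R * cis (r / R)"

definition inward_normal :: "real \<Rightarrow> real \<Rightarrow> complex" where
  "inward_normal R r = - cis (r / R)"

text \<open>\<open>post_velocity R (r, s) v\<close>: the particle leaves the boundary point with parameter \<open>r\<close> with
  unit velocity \<open>v\<close>, where \<open>s\<close> is the sine of the signed (counterclockwise) angle \<open>\<phi>\<close> from \<open>v\<close> to
  the inward normal.\<close>

definition post_velocity :: "real \<Rightarrow> real \<times> real \<Rightarrow> complex \<Rightarrow> bool" where
  "post_velocity R = (\<lambda>(r, s) v. norm v = 1 \<and>
     (\<exists>\<phi>\<in>{- pi / 2 .. pi / 2}. s = sin \<phi> \<and> inward_normal R r = cis \<phi> * v))"

definition reflect :: "complex \<Rightarrow> complex \<Rightarrow> complex" where
  "reflect n v = v - (2 * (v \<bullet> n)) *\<^sub>R n"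

text \<open>The collision space is a cylinder. It is represented by the fundamental domain
  \<open>[0, L) \<times> [-1, 1]\<close>; the Borel sets of the cylinder are precisely the Borel subsets of this
  domain.\<close>

definition collision_space :: "real \<Rightarrow> (real \<times> real) set" where
  "collision_space R = {0 ..< perimeter R} \<times> {-1 .. 1}"

definition collision_borel :: "real \<Rightarrow> (real \<times> real) measure" where
  "collision_borel R = restrict_space borel (collision_space R)"

definition collision_measure :: "real \<Rightarrow> (real \<times> real) measure" where
  "collision_measure R =
     density (restrict_space lborel (collision_space R)) (\<lambda>_. ennreal (1 / (2 * perimeter R)))"

definition next_collision :: "real \<Rightarrow> real \<times> real \<Rightarrow> real \<times> real \<Rightarrow> bool" where
  "next_collision R x y \<longleftrightarrow> y \<in> collision_space R \<and>
     (\<exists>v. post_velocity R x v \<and>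
       (\<exists>t>0. (\<forall>t'\<in>{0<..<t}. bdry R (fst x) + t' *\<^sub>R v \<in> ball 0 R) \<and>
              bdry R (fst x) + t *\<^sub>R v = bdry R (fst y)) \<and>
       post_velocity R y (reflect (inward_normal R (fst y)) v))"

text \<open>Tangential collisions (\<open>s = 1\<close> or \<open>s = -1\<close>, a null set) have no next collision; they are
  taken to be fixed.\<close>

definition billiard_map :: "real \<Rightarrow> real \<times> real \<Rightarrow> real \<times> real" where
  "billiard_map R x =
     (if \<exists>y. next_collision R x y then THE y. next_collision R x y else x)"

text \<open>The Jacobian matrix in the coordinates \<open>(r, s)\<close>. Where the coordinate representation of the
  map is not differentiable, the value is set to the identity. For \<open>billiard_map\<close> this happens on
  a null set only, comprising the tangential collisions and the preimage of the seam \<open>r = 0\<close>.\<close>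

definition jacobian_matrix :: "(real \<times> real \<Rightarrow> real \<times> real) \<Rightarrow> real \<times> real \<Rightarrow> real^2^2" where
  "jacobian_matrix T x =
     (if T differentiable (at x) then
        (let D = frechet_derivative T (at x) in
           vector [vector [fst (D (1, 0)), fst (D (0, 1))],
                   vector [snd (D (1, 0)), snd (D (0, 1))]])
      else mat 1)"

section \<open>Random perturbation\<close>

definition period_lattice :: "real \<Rightarrow> (real \<times> real) set" where
  "period_lattice R = {(perimeter R * of_int a, 2 * of_int b) | a b. True}"

definition perturbation :: "real \<Rightarrow> (real \<times> real) measure \<Rightarrow> real \<times> real \<Rightarrow> (real \<times> real) set \<Rightarrow> ennreal"
  where
  "perturbation R \<nu> x B = emeasure \<nu> {u. \<exists>w\<in>period_lattice R. u + x - w \<in> B}"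

text \<open>The transition function is only prescribed for almost every starting point, so any such
  version is admitted.\<close>

definition random_billiard_kernel ::
    "real \<Rightarrow> (real \<times> real) measure \<Rightarrow> (real \<times> real \<Rightarrow> (real \<times> real) measure) \<Rightarrow> bool" where
  "random_billiard_kernel R \<nu> P \<longleftrightarrow>
     P \<in> collision_borel R \<rightarrow>\<^sub>M prob_algebra (collision_borel R) \<and>
     (AE x in collision_measure R. \<forall>B\<in>sets (collision_borel R).
        emeasure (P x) B = perturbation R \<nu> (billiard_map R x) B)"

section \<open>Markov processes, ergodicity and Lyapunov exponents\<close>

text \<open>The law on sequence space of the Markov process with initial distribution \<open>\<mu>\<close> and transition
  function \<open>P\<close>, given by the Ionescu-Tulcea construction: the zeroth coordinate has law \<open>\<mu>\<close>, and
  coordinate \<open>n + 1\<close> has conditional law \<open>P (\<omega> n)\<close> given the coordinates \<open>\<omega> 0, \<dots>, \<omega> n\<close>.\<close>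

definition markov_step :: "'a measure \<Rightarrow> ('a \<Rightarrow> 'a measure) \<Rightarrow> nat \<Rightarrow> (nat \<Rightarrow> 'a) \<Rightarrow> 'a measure" where
  "markov_step \<mu> P n \<omega> = (case n of 0 \<Rightarrow> \<mu> | Suc k \<Rightarrow> P (\<omega> k))"

definition markov_law :: "'a measure \<Rightarrow> ('a \<Rightarrow> 'a measure) \<Rightarrow> (nat \<Rightarrow> 'a) measure" where
  "markov_law \<mu> P =
     projective_family.lim UNIV (Ionescu_Tulcea.CI (markov_step \<mu> P) (\<lambda>_. \<mu>)) (\<lambda>_. \<mu>)"

definition shift :: "(nat \<Rightarrow> 'a) \<Rightarrow> nat \<Rightarrow> 'a" where
  "shift \<omega> = (\<lambda>n. \<omega> (Suc n))"

definition markov_ergodic :: "'a measure \<Rightarrow> ('a \<Rightarrow> 'a measure) \<Rightarrow> bool" where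
  "markov_ergodic \<mu> P \<longleftrightarrow>
     (\<forall>A\<in>sets (PiM UNIV (\<lambda>_::nat. \<mu>)).
        shift -` A \<inter> space (PiM UNIV (\<lambda>_. \<mu>)) = A \<longrightarrow>
          emeasure (markov_law \<mu> P) A = 0 \<or> emeasure (markov_law \<mu> P) A = 1)"

primrec cocycle :: "('a \<Rightarrow> real^2^2) \<Rightarrow> nat \<Rightarrow> (nat \<Rightarrow> 'a) \<Rightarrow> real^2^2" where
  "cocycle D 0 \<omega> = mat 1"
| "cocycle D (Suc n) \<omega> = D (\<omega> n) ** cocycle D n \<omega>"

text \<open>Integrability is required explicitly, since the Bochner integral of a non-integrable function
  is \<open>0\<close> by convention.\<close>

definition lyapunov_exponents ::
    "(nat \<Rightarrow> 'a) measure \<Rightarrow> ('a \<Rightarrow> real^2^2) \<Rightarrow> real \<Rightarrow> real \<Rightarrow> bool" where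
  "lyapunov_exponents Q D l1 l2 \<longleftrightarrow>
     l1 \<ge> l2 \<and>
     (\<forall>n\<ge>1. integrable Q (\<lambda>\<omega>. ln (onorm ((*v) (cocycle D n \<omega>))))) \<and>
     (\<forall>n\<ge>1. integrable Q (\<lambda>\<omega>. ln \<bar>det (cocycle D n \<omega>)\<bar>)) \<and>
     (\<lambda>n. 1 / real n * (\<integral>\<omega>. ln (onorm ((*v) (cocycle D n \<omega>))) \<partial>Q)) \<longlonglongrightarrow> l1 \<and>
     (\<lambda>n. 1 / real n * (\<integral>\<omega>. ln \<bar>det (cocycle D n \<omega>)\<bar> \<partial>Q)) \<longlonglongrightarrow> l1 + l2"

end

theory Submission
  imports Defs
begin

text \<open>
  Let \<open>A\<close> be a shift-invariant event and \<open>h\<close> the conditional probability of \<open>A\<close> given the starting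
  point. By the Markov property \<open>h\<close> is harmonic, and since \<open>m\<close> is stationary the martingale
  \<open>h (x\<^sub>n)\<close> has constant second moment; hence \<open>h (x\<^sub>1) = h (x\<^sub>0)\<close> almost surely. The noise charges a
  ball around \<open>F (x\<^sub>0)\<close>, and the points \<open>F (x\<^sub>0)\<close> with \<open>x\<^sub>0\<close> typical are dense, so \<open>h\<close> is locally constant, hence constant
  on the connected collision space. Then \<open>A\<close> is independent of every cylinder, in particular of
  itself.

  In the coordinates \<open>(r, s)\<close> the circular billiard map is the shear
  \<open>(r + R (\<pi> - 2 arcsin s), s)\<close> modulo the perimeter. All its derivatives are unipotent upper
  triangular matrices, so the cocycle has determinant \<open>1\<close> and its off-diagonal entry is the
  Birkhoff sum of an integrable function. Its norm therefore grows at most linearly in mean, and by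
  concavity the mean of the logarithm is \<open>O (log n)\<close>.
\<close>

section \<open>Ergodicity of stationary Markov chains\<close>

text \<open>The path law is built from the initial distribution only, so \<open>h\<close> is not
  defined by restarting the chain at a point. It is the Radon-Nikodym density of the law of the
  starting point on \<open>A\<close>, and the Markov property is stated in tested form, as an
  identity of integrals against weights \<open>W\<close> of finitely many coordinates. This fits a
  kernel that is prescribed only almost everywhere. Invariance of \<open>m\<close> has to be derived
  as well. The billiard map jumps where arclength is reduced modulo the perimeter, so it is replaced
  by its lift, a shear of the plane. A shear followed by a fixed translation and reduction modulo
  the lattice does not enlarge preimages; total mass then forces equality. The same bound yields the
  density of typical images. The Jacobian defaults to the identity where the map is not
  differentiable. Differentiability is therefore decided at every collision, including the seam and
  the tangential ones, so that the cocycle is known along every path without an exceptional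
  set.\<close>

locale stationary_chain = prob_space \<mu> for \<mu> :: "'a measure" +
  fixes P :: "'a \<Rightarrow> 'a measure"
  assumes kernel: "P \<in> \<mu> \<rightarrow>\<^sub>M prob_algebra \<mu>"
    and invariant: "\<And>B. B \<in> sets \<mu> \<Longrightarrow> (\<integral>\<^sup>+x. emeasure (P x) B \<partial>\<mu>) = emeasure \<mu> B"
begin

abbreviation "path_space \<equiv> PiM UNIV (\<lambda>_::nat. \<mu>)"
abbreviation "path_law \<equiv> markov_law \<mu> P"
abbreviation past :: "nat \<Rightarrow> (nat \<Rightarrow> 'a) measure" where "past n \<equiv> PiM {0..<n} (\<lambda>_. \<mu>)"

lemma kernel_subprob[measurable]: "P \<in> \<mu> \<rightarrow>\<^sub>M subprob_algebra \<mu>"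
  using kernel by (rule measurable_prob_algebraD)

lemma prob_space_kernel: "x \<in> space \<mu> \<Longrightarrow> prob_space (P x)"
  and sets_kernel: "x \<in> space \<mu> \<Longrightarrow> sets (P x) = sets \<mu>"
  using measurable_space[OF kernel, of x] by (auto simp: space_prob_algebra)

sublocale IT: Ionescu_Tulcea "markov_step \<mu> P" "\<lambda>_. \<mu>"
proof (rule Ionescu_Tulcea.intro)
  show "markov_step \<mu> P i \<in> measurable (PiM {0..<i} (\<lambda>_. \<mu>)) (subprob_algebra \<mu>)" for i
  proof (cases i)
    case 0
    then show ?thesis
      by (simp add: markov_step_def[abs_def] M_in_subprob)
  next
    case (Suc k)
    then have [simp]: "k \<in> {0..<Suc k}" by simp
    have "(\<lambda>\<omega>. P (\<omega> k)) \<in> measurable (PiM {0..<Suc k} (\<lambda>_. \<mu>)) (subprob_algebra \<mu>)"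
      by (rule measurable_compose[OF _ kernel_subprob]) (simp add: measurable_component_singleton)
    with Suc show ?thesis
      by (simp add: markov_step_def[abs_def])
  qed
next
  show "prob_space (markov_step \<mu> P i x)" if "x \<in> space (PiM {0..<i} (\<lambda>_. \<mu>))" for i x
    using that by (cases i) (auto simp: markov_step_def prob_space_axioms space_PiM intro!: prob_space_kernel)
qed

section \<open>Finite-dimensional marginals of the path law\<close>

lemma path_law_eq: "path_law = IT.PF.lim"
  by (simp add: markov_law_def)

lemma sets_path_law[simp, measurable_cong]: "sets path_law = sets path_space"
  and space_path_law[simp]: "space path_law = space path_space"
  by (simp_all add: path_law_eq)

lemma measurable_restrict_past[measurable]: "(\<lambda>\<omega>. restrict \<omega> {0..<n}) \<in> path_space \<rightarrow>\<^sub>M past n"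
  by (intro measurable_restrict_subset) simp

text \<open>\<open>IT.CI J\<close> runs the chain up to time \<open>IT.up_to J\<close> and projects
  to \<open>J\<close>. Knowing this time for an initial segment identifies its marginal with the
  plain iterate \<open>IT.C 0 n\<close>.\<close>

lemma up_to_Ico: "IT.up_to {0..<n} = n"
proof (rule antisym)
  show "IT.up_to {0..<n} \<le> n" by (simp add: IT.up_to_iff_Ico)
  show "n \<le> IT.up_to {0..<n}"
    using IT.up_to_less[of "{0..<n}" "n - 1"] by (cases n) auto
qed

lemma distr_past: "distr path_law (past n) (\<lambda>\<omega>. restrict \<omega> {0..<n}) = IT.C 0 n (\<lambda>_. undefined)"
proof -
  have sp: "(\<lambda>_. undefined) \<in> space (past 0)" by (simp add: space_PiM)
  have "distr path_law (past n) (\<lambda>\<omega>. restrict \<omega> {0..<n}) = IT.CI {0..<n}"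
    unfolding path_law_eq by (rule IT.distr_lim) simp
  also have "\<dots> = distr (IT.C 0 n (\<lambda>_. undefined)) (past n) (\<lambda>f. restrict f {0..<n})"
    by (simp add: IT.CI_def up_to_Ico)
  also have "\<dots> = distr (IT.C 0 n (\<lambda>_. undefined)) (IT.C 0 n (\<lambda>_. undefined)) (\<lambda>f. f)"
    using IT.sets_C[OF sp, of n] IT.space_C[OF sp, of n] by (intro distr_cong) (auto simp: space_PiM PiE_restrict)
  finally show ?thesis by (simp add: distr_id)
qed

text \<open>Total mass can be read off any marginal; the empty initial segment is the simplest
  one.\<close>

lemma prob_space_path_law: "prob_space path_law"
proof (rule prob_space_distrD)
  show "(\<lambda>\<omega>. restrict \<omega> {0..<0}) \<in> path_law \<rightarrow>\<^sub>M past 0"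
    by (simp add: measurable_cong_sets[OF sets_path_law refl] del: atLeastLessThan_empty)
  show "prob_space (distr path_law (past 0) (\<lambda>\<omega>. restrict \<omega> {0..<0}))"
    unfolding distr_past by (rule IT.prob_space_C) (simp add: space_PiM)
qed

lemma nn_integral_past:
  assumes [measurable]: "f \<in> borel_measurable (past n)"
  shows "(\<integral>\<^sup>+\<omega>. f (restrict \<omega> {0..<n}) \<partial>path_law) = (\<integral>\<^sup>+\<omega>. f \<omega> \<partial>IT.C 0 n (\<lambda>_. undefined))"
  unfolding distr_past[symmetric] by (subst nn_integral_distr) auto

lemma nn_integral_step:
  assumes G[measurable]: "G \<in> borel_measurable (past (Suc n))"
  shows "(\<integral>\<^sup>+\<omega>. G (restrict \<omega> {0..<Suc n}) \<partial>path_law) =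
    (\<integral>\<^sup>+\<omega>. (\<integral>\<^sup>+y. G ((restrict \<omega> {0..<n})(n := y)) \<partial>markov_step \<mu> P n (restrict \<omega> {0..<n})) \<partial>path_law)"
proof -
  have sp: "(\<lambda>_. undefined) \<in> space (past 0)" by (simp add: space_PiM)
  have [measurable]: "(\<lambda>\<omega>. integral\<^sup>N (IT.eP n \<omega>) G) \<in> borel_measurable (past n)"
    by (rule nn_integral_measurable_subprob_algebra2[where N="past (Suc n)"])
       (auto simp: measurable_split_conv)
  have "(\<integral>\<^sup>+\<omega>. G (restrict \<omega> {0..<Suc n}) \<partial>path_law) = (\<integral>\<^sup>+\<omega>. G \<omega> \<partial>IT.C 0 (Suc n) (\<lambda>_. undefined))"
    by (rule nn_integral_past) simp
  also have "\<dots> = (\<integral>\<^sup>+\<omega>. (\<integral>\<^sup>+y. G y \<partial>IT.eP n \<omega>) \<partial>IT.C 0 n (\<lambda>_. undefined))"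
    using IT.sets_C[OF sp, of n]
    by (simp, subst nn_integral_bind[where B="past (Suc n)"]) (auto simp: measurable_cong_sets[OF IT.sets_C[OF sp, of n] refl])
  also have "\<dots> = (\<integral>\<^sup>+\<omega>. (\<integral>\<^sup>+y. G y \<partial>IT.eP n (restrict \<omega> {0..<n})) \<partial>path_law)"
    by (rule nn_integral_past[symmetric]) simp
  also have "\<dots> = (\<integral>\<^sup>+\<omega>. (\<integral>\<^sup>+y. G ((restrict \<omega> {0..<n})(n := y)) \<partial>markov_step \<mu> P n (restrict \<omega> {0..<n})) \<partial>path_law)"
    by (intro nn_integral_cong IT.nn_integral_eP) (auto simp: space_PiM)
  finally show ?thesis .
qed

lemma measurable_kernel_integral[measurable]:
  assumes [measurable]: "f \<in> borel_measurable \<mu>"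
  shows "(\<lambda>x. \<integral>\<^sup>+y. f y \<partial>P x) \<in> borel_measurable \<mu>"
  by (rule nn_integral_measurable_subprob_algebra2[where N=\<mu>]) auto

text \<open>The weight sees only coordinates up to \<open>n\<close>, so it is a constant factor
  while coordinate \<open>n + 1\<close> is integrated out. This is the one-step Markov property,
  with conditioning on the past replaced by testing against \<open>W\<close>.\<close>

lemma nn_integral_markov_step:
  assumes W[measurable]: "W \<in> borel_measurable (past (Suc n))" and f[measurable]: "f \<in> borel_measurable \<mu>"
  shows "(\<integral>\<^sup>+\<omega>. W (restrict \<omega> {0..<Suc n}) * f (\<omega> (Suc n)) \<partial>path_law) =
    (\<integral>\<^sup>+\<omega>. W (restrict \<omega> {0..<Suc n}) * (\<integral>\<^sup>+y. f y \<partial>P (\<omega> n)) \<partial>path_law)"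
proof -
  have [measurable]: "(\<lambda>\<omega>. restrict \<omega> {0..<Suc n}) \<in> past (Suc (Suc n)) \<rightarrow>\<^sub>M past (Suc n)"
    by (intro measurable_restrict_subset) auto
  have [measurable]: "(\<lambda>\<omega>. \<omega> (Suc n)) \<in> past (Suc (Suc n)) \<rightarrow>\<^sub>M \<mu>"
    by (rule measurable_component_singleton) auto
  define G where "G \<omega> = W (restrict \<omega> {0..<Suc n}) * f (\<omega> (Suc n))" for \<omega>
  have G: "G \<in> borel_measurable (past (Suc (Suc n)))"
    unfolding G_def by measurable
  have upd: "restrict ((restrict \<omega> {0..<Suc n})(Suc n := y)) {0..<Suc n} = restrict \<omega> {0..<Suc n}" for \<omega> :: "nat \<Rightarrow> 'a" and y
    by (auto simp: restrict_def)
  have res: "restrict (restrict \<omega> {0..<Suc (Suc n)}) {0..<Suc n} = restrict \<omega> {0..<Suc n}" for \<omega> :: "nat \<Rightarrow> 'a"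
    by (auto simp: restrict_def)
  have "(\<integral>\<^sup>+\<omega>. W (restrict \<omega> {0..<Suc n}) * f (\<omega> (Suc n)) \<partial>path_law) =
    (\<integral>\<^sup>+\<omega>. G (restrict \<omega> {0..<Suc (Suc n)}) \<partial>path_law)"
    unfolding G_def res by simp
  also have "\<dots> = (\<integral>\<^sup>+\<omega>. (\<integral>\<^sup>+y. G ((restrict \<omega> {0..<Suc n})(Suc n := y))
      \<partial>markov_step \<mu> P (Suc n) (restrict \<omega> {0..<Suc n})) \<partial>path_law)"
    by (rule nn_integral_step) (rule G)
  also have "\<dots> = (\<integral>\<^sup>+\<omega>. W (restrict \<omega> {0..<Suc n}) * (\<integral>\<^sup>+y. f y \<partial>P (\<omega> n)) \<partial>path_law)"
  proof (intro nn_integral_cong)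
    fix \<omega> assume "\<omega> \<in> space path_law"
    then have "\<omega> n \<in> space \<mu>" by (auto simp: space_PiM)
    then have [measurable]: "f \<in> borel_measurable (P (\<omega> n))"
      using f sets_kernel by (simp add: measurable_cong_sets[OF sets_kernel refl])
    show "(\<integral>\<^sup>+y. G ((restrict \<omega> {0..<Suc n})(Suc n := y)) \<partial>markov_step \<mu> P (Suc n) (restrict \<omega> {0..<Suc n})) =
        W (restrict \<omega> {0..<Suc n}) * (\<integral>\<^sup>+y. f y \<partial>P (\<omega> n))"
      unfolding G_def upd by (simp add: markov_step_def nn_integral_cmult)
  qed
  finally show ?thesis .
qed

lemma nn_integral_invariant:
  assumes f: "f \<in> borel_measurable \<mu>"
  shows "(\<integral>\<^sup>+x. \<integral>\<^sup>+y. f y \<partial>P x \<partial>\<mu>) = (\<integral>\<^sup>+x. f x \<partial>\<mu>)"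
proof -
  have "bind \<mu> P = \<mu>"
  proof (rule measure_eqI)
    have s: "sets (bind \<mu> P) = sets \<mu>"
      by (rule sets_bind[OF sets_kernel not_empty])
    then show "sets (bind \<mu> P) = sets \<mu>" .
    fix X assume "X \<in> sets (bind \<mu> P)"
    with s have "X \<in> sets \<mu>" by simp
    then show "emeasure (bind \<mu> P) X = emeasure \<mu> X"
      by (subst emeasure_bind[OF not_empty kernel_subprob]) (auto simp: invariant)
  qed
  then show ?thesis
    using nn_integral_bind[OF f kernel_subprob] by simp
qed

text \<open>The induction generalises over \<open>f\<close>: going back one step replaces
  \<open>f\<close> by its average under the kernel, and invariance of \<mu> removes that average at
  the end.\<close>

lemma nn_integral_coordinate:
  assumes f: "f \<in> borel_measurable \<mu>"
  shows "(\<integral>\<^sup>+\<omega>. f (\<omega> n) \<partial>path_law) = (\<integral>\<^sup>+x. f x \<partial>\<mu>)"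
  using f
proof (induction n arbitrary: f)
  case 0
  note [measurable] = 0
  have m: "(\<lambda>\<omega>. f (\<omega> 0)) \<in> borel_measurable (past (Suc 0))"
    by (rule measurable_compose[OF _ 0]) (simp add: measurable_component_singleton)
  interpret Q: prob_space path_law by (rule prob_space_path_law)
  show ?case
    using nn_integral_step[OF m] Q.emeasure_space_1 by (simp add: markov_step_def)
next
  case (Suc n)
  note [measurable] = Suc.prems
  have "(\<integral>\<^sup>+\<omega>. f (\<omega> (Suc n)) \<partial>path_law) = (\<integral>\<^sup>+\<omega>. (\<integral>\<^sup>+y. f y \<partial>P (\<omega> n)) \<partial>path_law)"
    using nn_integral_markov_step[of "\<lambda>_. 1" n f] by simp
  also have "\<dots> = (\<integral>\<^sup>+x. \<integral>\<^sup>+y. f y \<partial>P x \<partial>\<mu>)"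
    by (rule Suc.IH) simp
  also have "\<dots> = (\<integral>\<^sup>+x. f x \<partial>\<mu>)"
    by (rule nn_integral_invariant) simp
  finally show ?case .
qed

lemma distr_coordinate: "distr path_law \<mu> (\<lambda>\<omega>. \<omega> n) = \<mu>"
proof (rule measure_eqI)
  fix B assume "B \<in> sets (distr path_law \<mu> (\<lambda>\<omega>. \<omega> n))"
  then have [measurable]: "B \<in> sets \<mu>" by simp
  have "emeasure (distr path_law \<mu> (\<lambda>\<omega>. \<omega> n)) B = (\<integral>\<^sup>+x. indicator B x \<partial>distr path_law \<mu> (\<lambda>\<omega>. \<omega> n))"
    by simp
  also have "\<dots> = (\<integral>\<^sup>+\<omega>. indicator B (\<omega> n) \<partial>path_law)"
    by (subst nn_integral_distr) simp_all
  finally show "emeasure (distr path_law \<mu> (\<lambda>\<omega>. \<omega> n)) B = emeasure \<mu> B"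
    using nn_integral_coordinate[of "indicator B" n] by simp
qed simp

lemma AE_coordinate:
  assumes "AE x in \<mu>. Q x"
  shows "AE \<omega> in path_law. Q (\<omega> n)"
  using AE_distrD[of "\<lambda>\<omega>. \<omega> n" path_law \<mu> Q] assms
  unfolding distr_coordinate by simp

section \<open>The Markov property for weighted path laws\<close>

lemma measurable_shift_by: "(\<lambda>\<omega> i. \<omega> (n + i)) \<in> path_space \<rightarrow>\<^sub>M path_space"
  by (rule measurable_PiM_single') (auto simp: space_PiM)

text \<open>Integrating out a block of future coordinates one by one compresses it into a function
  \<open>g\<close> of the present state. The point is that one \<open>g\<close> serves all times
  \<open>n\<close> and all past weights \<open>W\<close>. The terminal factor \<open>f\<close> is
  there for the induction: integrating out the last coordinate produces a new terminal factor one
  step earlier.\<close>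

lemma cylinder_tail_weight:
  fixes B :: "nat \<Rightarrow> 'a set"
  assumes B[measurable]: "\<And>i. B i \<in> sets \<mu>" and f: "f \<in> borel_measurable \<mu>"
  shows "\<exists>g\<in>borel_measurable \<mu>. \<forall>n. \<forall>W\<in>borel_measurable (past (Suc n)).
    (\<integral>\<^sup>+\<omega>. W (restrict \<omega> {0..<Suc n}) * ((\<Prod>i\<le>k. indicator (B i) (\<omega> (n + i))) * f (\<omega> (n + k))) \<partial>path_law) =
    (\<integral>\<^sup>+\<omega>. W (restrict \<omega> {0..<Suc n}) * g (\<omega> n) \<partial>path_law)"
  using f
proof (induction k arbitrary: f)
  case 0
  note [measurable] = 0
  show ?case
    by (rule bexI[of _ "\<lambda>x. indicator (B 0) x * f x"]) simp_all
next
  case (Suc k)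
  note [measurable] = Suc.prems
  define f' where "f' x = (\<integral>\<^sup>+y. indicator (B (Suc k)) y * f y \<partial>P x)" for x
  have f'[measurable]: "f' \<in> borel_measurable \<mu>"
    unfolding f'_def by (rule measurable_kernel_integral) measurable
  from Suc.IH[OF f'] obtain g where g: "g \<in> borel_measurable \<mu>" and
    IH: "\<And>n W. W \<in> borel_measurable (past (Suc n)) \<Longrightarrow>
    (\<integral>\<^sup>+\<omega>. W (restrict \<omega> {0..<Suc n}) * ((\<Prod>i\<le>k. indicator (B i) (\<omega> (n + i))) * f' (\<omega> (n + k))) \<partial>path_law) =
    (\<integral>\<^sup>+\<omega>. W (restrict \<omega> {0..<Suc n}) * g (\<omega> n) \<partial>path_law)"
    by blast
  have "(\<integral>\<^sup>+\<omega>. W (restrict \<omega> {0..<Suc n}) * ((\<Prod>i\<le>Suc k. indicator (B i) (\<omega> (n + i))) * f (\<omega> (n + Suc k))) \<partial>path_law) =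
    (\<integral>\<^sup>+\<omega>. W (restrict \<omega> {0..<Suc n}) * g (\<omega> n) \<partial>path_law)"
    if W[measurable]: "W \<in> borel_measurable (past (Suc n))" for n W
  proof -
    \<comment> \<open>The indicators up to time \<open>n + k\<close> are absorbed into the past
      weight, which leaves a single future coordinate for the one-step Markov property.\<close>
    define V where "V \<omega> = W (restrict \<omega> {0..<Suc n}) * (\<Prod>i\<le>k. indicator (B i) (\<omega> (n + i)))" for \<omega>
    have [measurable]: "(\<lambda>\<omega>. restrict \<omega> {0..<Suc n}) \<in> past (Suc (n + k)) \<rightarrow>\<^sub>M past (Suc n)"
      by (intro measurable_restrict_subset) auto
    have "(\<lambda>\<omega>. indicator (B i) (\<omega> (n + i)) :: ennreal) \<in> borel_measurable (past (Suc (n + k)))" if "i \<le> k" for i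
      by (rule measurable_compose[of _ _ \<mu>]) (use that in \<open>auto intro!: measurable_component_singleton\<close>)
    then have V: "V \<in> borel_measurable (past (Suc (n + k)))"
      unfolding V_def by (intro borel_measurable_times_ennreal borel_measurable_prod_ennreal) auto
    have V_restrict: "V (restrict \<omega> {0..<Suc (n + k)}) =
        W (restrict \<omega> {0..<Suc n}) * (\<Prod>i\<le>k. indicator (B i) (\<omega> (n + i)))" for \<omega>
    proof -
      have "restrict (restrict \<omega> {0..<Suc (n + k)}) {0..<Suc n} = restrict \<omega> {0..<Suc n}"
        by (auto simp: restrict_def)
      then show ?thesis
        unfolding V_def by (auto intro!: arg_cong2[where f="(*)"] prod.cong)
    qed
    have "(\<integral>\<^sup>+\<omega>. W (restrict \<omega> {0..<Suc n}) * ((\<Prod>i\<le>Suc k. indicator (B i) (\<omega> (n + i))) * f (\<omega> (n + Suc k))) \<partial>path_law) =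
      (\<integral>\<^sup>+\<omega>. V (restrict \<omega> {0..<Suc (n + k)}) * (indicator (B (Suc k)) (\<omega> (Suc (n + k))) * f (\<omega> (Suc (n + k)))) \<partial>path_law)"
      unfolding V_restrict by (simp add: mult_ac)
    also have "\<dots> = (\<integral>\<^sup>+\<omega>. V (restrict \<omega> {0..<Suc (n + k)}) * f' (\<omega> (n + k)) \<partial>path_law)"
      unfolding f'_def by (rule nn_integral_markov_step[OF V]) simp
    also have "\<dots> = (\<integral>\<^sup>+\<omega>. W (restrict \<omega> {0..<Suc n}) * g (\<omega> n) \<partial>path_law)"
      unfolding V_restrict using IH[OF W] by (simp add: mult_ac)
    finally show ?thesis .
  qed
  with g show ?case by blast
qed

text \<open>By stationarity coordinate \<open>n\<close> has law \<mu>, so its law under the weighted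
  path measure is absolutely continuous and has a Radon-Nikodym density. This \<open>k\<close> plays
  the role of the conditional expectation of \<open>W\<close> given the state at time
  \<open>n\<close>.\<close>

lemma ex_law_weight:
  assumes W[measurable]: "W \<in> borel_measurable path_space" and fin: "(\<integral>\<^sup>+\<omega>. W \<omega> \<partial>path_law) < \<infinity>"
  shows "\<exists>k\<in>borel_measurable \<mu>. \<forall>f\<in>borel_measurable \<mu>.
    (\<integral>\<^sup>+\<omega>. W \<omega> * f (\<omega> n) \<partial>path_law) = (\<integral>\<^sup>+x. k x * f x \<partial>\<mu>)"
proof -
  have m: "(\<lambda>\<omega>. \<omega> n) \<in> density path_law W \<rightarrow>\<^sub>M \<mu>"
    using measurable_component_singleton[of n UNIV "\<lambda>_. \<mu>"]
    by (simp add: measurable_cong_sets[of "density path_law W" path_space])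
  define N where "N = distr (density path_law W) \<mu> (\<lambda>\<omega>. \<omega> n)"
  have N: "(\<integral>\<^sup>+x. f x \<partial>N) = (\<integral>\<^sup>+\<omega>. W \<omega> * f (\<omega> n) \<partial>path_law)" if [measurable]: "f \<in> borel_measurable \<mu>" for f
    unfolding N_def using that by (subst nn_integral_distr[OF m]) (simp_all add: nn_integral_density)
  have sets_N[simp]: "sets N = sets \<mu>" by (simp add: N_def)
  have space_N: "space N = space \<mu>" by (simp add: N_def)
  have "emeasure N (space N) = (\<integral>\<^sup>+x. 1 \<partial>N)" by simp
  also have "\<dots> = (\<integral>\<^sup>+\<omega>. W \<omega> \<partial>path_law)" by (subst N) simp_all
  finally have "finite_measure N"
    using fin by (intro finite_measureI) simp
  moreover have "absolutely_continuous \<mu> N"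
    unfolding absolutely_continuous_def
  proof (rule subsetI)
    fix B assume B: "B \<in> null_sets \<mu>"
    then have [measurable]: "B \<in> sets \<mu>" by auto
    have "AE \<omega> in path_law. indicator B (\<omega> n) = (0::ennreal)"
      using AE_coordinate[OF AE_not_in[OF B], of n] by eventually_elim simp
    then have "(\<integral>\<^sup>+\<omega>. W \<omega> * indicator B (\<omega> n) \<partial>path_law) = 0"
      by (subst nn_integral_0_iff_AE) auto
    then show "B \<in> null_sets N"
      using N[of "indicator B"] by (simp add: null_sets_def)
  qed
  ultimately obtain k where [measurable]: "k \<in> borel_measurable \<mu>" and k: "density \<mu> k = N"
    using Radon_Nikodym_finite_measure[of N] by auto
  have "(\<integral>\<^sup>+\<omega>. W \<omega> * f (\<omega> n) \<partial>path_law) = (\<integral>\<^sup>+x. k x * f x \<partial>\<mu>)" if [measurable]: "f \<in> borel_measurable \<mu>" for f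
    using N[OF that] unfolding k[symmetric] by (simp add: nn_integral_density)
  then show ?thesis by (intro bexI[of _ k]) auto
qed

text \<open>Cylinders determine a finite measure on the product space, and a cylinder over any
  finite index set becomes one over an initial segment by padding with the whole space. Products
  over \<open>{..k}\<close> match the form of \<open>cylinder_tail_weight\<close>.\<close>

lemma path_measure_eqI:
  assumes s: "sets M = sets path_space" "sets N = sets path_space" and "finite_measure M"
    and eq: "\<And>B k. (\<And>i. B i \<in> sets \<mu>) \<Longrightarrow>
      (\<integral>\<^sup>+\<omega>. (\<Prod>i\<le>k. indicator (B i) (\<omega> i)) \<partial>M) = (\<integral>\<^sup>+\<omega>. (\<Prod>i\<le>k. indicator (B i) (\<omega> i)) \<partial>N)"
  shows "M = N"
proof (rule measure_eqI_PiM_infinite[OF s])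
  fix A and J :: "nat set"
  assume J: "finite J" and A: "\<And>i. i \<in> J \<Longrightarrow> A i \<in> sets \<mu>"
  define B where "B i = (if i \<in> J then A i else space \<mu>)" for i
  have B: "B i \<in> sets \<mu>" for i using A by (auto simp: B_def)
  obtain k where k: "\<And>i. i \<in> J \<Longrightarrow> i \<le> k" using J by (meson finite_nat_set_iff_bounded_le)
  let ?E = "prod_emb UNIV (\<lambda>_. \<mu>) J (Pi\<^sub>E J A)"
  have E: "?E \<in> sets path_space"
    by (rule sets_PiM_I[OF J]) (use A in auto)
  have ind: "indicator ?E \<omega> = (\<Prod>i\<le>k. indicator (B i) (\<omega> i) :: ennreal)" if "\<omega> \<in> space path_space" for \<omega>
  proof (cases "\<omega> \<in> ?E")
    case True
    then have "\<omega> i \<in> B i" for i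
      using that by (auto simp: B_def prod_emb_def space_PiM PiE_iff)
    with True show ?thesis by simp
  next
    case False
    with that have "\<exists>i\<in>J. \<omega> i \<notin> A i"
      by (auto simp: prod_emb_def space_PiM PiE_iff)
    then obtain i where i: "i \<in> J" "\<omega> i \<notin> A i" by blast
    then have "(\<Prod>i\<le>k. indicator (B i) (\<omega> i) :: ennreal) = 0"
      using k by (intro prod_zero bexI[of _ i]) (auto simp: B_def)
    with False show ?thesis by simp
  qed
  have "emeasure X ?E = (\<integral>\<^sup>+\<omega>. (\<Prod>i\<le>k. indicator (B i) (\<omega> i)) \<partial>X)" if "sets X = sets path_space" for X
  proof -
    have "emeasure X ?E = (\<integral>\<^sup>+\<omega>. indicator ?E \<omega> \<partial>X)"
      using E that by simp
    also have "\<dots> = (\<integral>\<^sup>+\<omega>. (\<Prod>i\<le>k. indicator (B i) (\<omega> i)) \<partial>X)"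
      by (intro nn_integral_cong ind) (use sets_eq_imp_space_eq[OF that] in auto)
    finally show ?thesis .
  qed
  with eq[OF B] s show "emeasure M ?E = emeasure N ?E" by simp
qed fact

text \<open>Weighting the path law by a function \<open>W\<close> of the first coordinates and then shifting has the
  same effect as reweighting only the starting point, by the density \<open>k\<close> of the law that \<open>W\<close>
  induces on the present state.\<close>

lemma markov_property:
  assumes W[measurable]: "W \<in> borel_measurable (past (Suc n))"
    and fin: "(\<integral>\<^sup>+\<omega>. W (restrict \<omega> {0..<Suc n}) \<partial>path_law) < \<infinity>"
    and k[measurable]: "k \<in> borel_measurable \<mu>"
    and eq: "\<And>f. f \<in> borel_measurable \<mu> \<Longrightarrow>
      (\<integral>\<^sup>+\<omega>. W (restrict \<omega> {0..<Suc n}) * f (\<omega> n) \<partial>path_law) = (\<integral>\<^sup>+x. k x * f x \<partial>\<mu>)"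
    and E[measurable]: "E \<in> sets path_space"
  shows "(\<integral>\<^sup>+\<omega>. W (restrict \<omega> {0..<Suc n}) * indicator E (\<lambda>i. \<omega> (n + i)) \<partial>path_law) =
    (\<integral>\<^sup>+\<omega>. k (\<omega> 0) * indicator E \<omega> \<partial>path_law)"
proof -
  define V where "V \<omega> = W (restrict \<omega> {0..<Suc n})" for \<omega>
  have V[measurable]: "V \<in> borel_measurable path_space"
    unfolding V_def by (rule measurable_compose[OF measurable_restrict_past W])
  define M where "M = distr (density path_law V) path_space (\<lambda>\<omega> i. \<omega> (n + i))"
  define N where "N = density path_law (\<lambda>\<omega>. k (\<omega> 0))"
  have m: "(\<lambda>\<omega> i. \<omega> (n + i)) \<in> density path_law V \<rightarrow>\<^sub>M path_space"
    using measurable_shift_by[of n] by (simp add: measurable_cong_sets[of "density path_law V" path_space])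
  have s: "sets M = sets path_space" "sets N = sets path_space"
    by (simp_all add: M_def N_def)
  have M: "(\<integral>\<^sup>+\<omega>. F \<omega> \<partial>M) = (\<integral>\<^sup>+\<omega>. V \<omega> * F (\<lambda>i. \<omega> (n + i)) \<partial>path_law)"
    if [measurable]: "F \<in> borel_measurable path_space" for F
    unfolding M_def using measurable_compose[OF measurable_shift_by that]
    by (subst nn_integral_distr[OF m]) (simp_all add: nn_integral_density)
  have k0[measurable]: "(\<lambda>\<omega>. k (\<omega> 0)) \<in> borel_measurable path_space"
    by (rule measurable_compose[OF _ k]) (simp add: measurable_component_singleton)
  have N: "(\<integral>\<^sup>+\<omega>. F \<omega> \<partial>N) = (\<integral>\<^sup>+\<omega>. k (\<omega> 0) * F \<omega> \<partial>path_law)"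
    if [measurable]: "F \<in> borel_measurable path_space" for F
    unfolding N_def by (rule nn_integral_density) simp_all
  have "emeasure M (space M) = (\<integral>\<^sup>+\<omega>. 1 \<partial>M)" by simp
  also have "\<dots> < \<infinity>" using fin by (subst M) (simp_all add: V_def)
  finally have "finite_measure M" by (intro finite_measureI) simp
  then have "M = N"
  proof (rule path_measure_eqI[OF s])
    fix B :: "nat \<Rightarrow> 'a set" and j assume B[measurable]: "\<And>i. B i \<in> sets \<mu>"
    \<comment> \<open>The same \<open>g\<close> is used at time \<open>n\<close> with weight
      \<open>W\<close> and at time 0 with weight \<open>k\<close>; this is where homogeneity in time
      enters.\<close>
    obtain g where [measurable]: "g \<in> borel_measurable \<mu>" and g: "\<And>n W. W \<in> borel_measurable (past (Suc n)) \<Longrightarrow>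
      (\<integral>\<^sup>+\<omega>. W (restrict \<omega> {0..<Suc n}) * ((\<Prod>i\<le>j. indicator (B i) (\<omega> (n + i))) * 1) \<partial>path_law) =
      (\<integral>\<^sup>+\<omega>. W (restrict \<omega> {0..<Suc n}) * g (\<omega> n) \<partial>path_law)"
      using cylinder_tail_weight[of B "\<lambda>_. 1" j, OF B] by auto
    have k0: "(\<lambda>\<omega>. k (\<omega> 0)) \<in> borel_measurable (past (Suc 0))"
      by (rule measurable_compose[OF _ k]) (simp add: measurable_component_singleton)
    have "(\<integral>\<^sup>+\<omega>. (\<Prod>i\<le>j. indicator (B i) (\<omega> i)) \<partial>M) = (\<integral>\<^sup>+\<omega>. W (restrict \<omega> {0..<Suc n}) * g (\<omega> n) \<partial>path_law)"
      using g[OF W] by (subst M) (simp_all add: V_def)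
    also have "\<dots> = (\<integral>\<^sup>+x. k x * g x \<partial>\<mu>)" by (rule eq) simp
    also have "\<dots> = (\<integral>\<^sup>+\<omega>. k (\<omega> 0) * g (\<omega> 0) \<partial>path_law)"
      by (rule nn_integral_coordinate[symmetric]) simp
    also have "\<dots> = (\<integral>\<^sup>+\<omega>. k (\<omega> 0) * (\<Prod>i\<le>j. indicator (B i) (\<omega> i)) \<partial>path_law)"
      using g[OF k0] by simp
    also have "\<dots> = (\<integral>\<^sup>+\<omega>. (\<Prod>i\<le>j. indicator (B i) (\<omega> i)) \<partial>N)"
      by (subst N) simp_all
    finally show "(\<integral>\<^sup>+\<omega>. (\<Prod>i\<le>j. indicator (B i) (\<omega> i)) \<partial>M) = (\<integral>\<^sup>+\<omega>. (\<Prod>i\<le>j. indicator (B i) (\<omega> i)) \<partial>N)" .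
  qed
  then show ?thesis
    using M[of "indicator E"] N[of "indicator E"] by (simp add: V_def)
qed

section \<open>Invariant events and harmonic functions\<close>

lemma shift_in_path_space: "\<omega> \<in> space path_space \<Longrightarrow> (\<lambda>i. \<omega> (n + i)) \<in> space path_space"
  by (auto simp: space_PiM)

lemma shift_invariant_tail:
  assumes A: "shift -` A \<inter> space path_space = A" and "\<omega> \<in> space path_space"
  shows "(\<lambda>i. \<omega> (n + i)) \<in> A \<longleftrightarrow> \<omega> \<in> A"
proof (induction n)
  case (Suc n)
  have "(\<lambda>i. \<omega> (Suc n + i)) = shift (\<lambda>i. \<omega> (n + i))" by (simp add: shift_def)
  then have "(\<lambda>i. \<omega> (Suc n + i)) \<in> A \<longleftrightarrow> (\<lambda>i. \<omega> (n + i)) \<in> shift -` A \<inter> space path_space"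
    using shift_in_path_space[OF assms(2)] by auto
  then show ?case using A Suc.IH by auto
qed simp

text \<open>Invariance allows \<open>A\<close> to be tested on the path seen from time
  \<open>n\<close>, where the Markov property reduces it to a reweighted start. Thus one function
  \<open>h\<close> gives the conditional probability of \<open>A\<close> given the coordinates up to
  \<open>n\<close>, for every \<open>n\<close> at once.\<close>

lemma ex_invariant_density:
  assumes A[measurable]: "A \<in> sets path_space" and inv: "shift -` A \<inter> space path_space = A"
  obtains h :: "'a \<Rightarrow> real" where "h \<in> borel_measurable \<mu>" "\<And>x. 0 \<le> h x" "\<And>x. h x \<le> 1"
    "\<And>n W. W \<in> borel_measurable (past (Suc n)) \<Longrightarrow>
      (\<integral>\<^sup>+\<omega>. W (restrict \<omega> {0..<Suc n}) \<partial>path_law) < \<infinity> \<Longrightarrow>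
      (\<integral>\<^sup>+\<omega>. W (restrict \<omega> {0..<Suc n}) * indicator A \<omega> \<partial>path_law) =
      (\<integral>\<^sup>+\<omega>. W (restrict \<omega> {0..<Suc n}) * ennreal (h (\<omega> n)) \<partial>path_law)"
proof -
  interpret Q: prob_space path_law by (rule prob_space_path_law)
  have "(\<integral>\<^sup>+\<omega>. indicator A \<omega> \<partial>path_law) < \<infinity>"
    by (simp add: Q.emeasure_eq_measure)
  from ex_law_weight[OF _ this, of 0] obtain h where h[measurable]: "h \<in> borel_measurable \<mu>"
    and h_eq: "\<And>f. f \<in> borel_measurable \<mu> \<Longrightarrow>
      (\<integral>\<^sup>+\<omega>. indicator A \<omega> * f (\<omega> 0) \<partial>path_law) = (\<integral>\<^sup>+x. h x * f x \<partial>\<mu>)"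
    by auto
  have "AE x in \<mu>. h x \<le> 1"
  proof (rule AE_I')
    let ?B = "{x \<in> space \<mu>. 1 < h x}"
    \<comment> \<open>On the set where the density exceeds 1 it integrates to at most the measure of
      that set, which is possible only for a null set.\<close>
    have h_le: "(\<integral>\<^sup>+x. h x * indicator ?B x \<partial>\<mu>) \<le> (\<integral>\<^sup>+x. indicator ?B x \<partial>\<mu>)"
    proof -
      have "(\<integral>\<^sup>+x. h x * indicator ?B x \<partial>\<mu>) = (\<integral>\<^sup>+\<omega>. indicator A \<omega> * indicator ?B (\<omega> 0) \<partial>path_law)"
        by (rule h_eq[symmetric]) measurable
      also have "\<dots> \<le> (\<integral>\<^sup>+\<omega>. indicator ?B (\<omega> 0) \<partial>path_law)"
        by (intro nn_integral_mono) (auto split: split_indicator)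
      also have "\<dots> = (\<integral>\<^sup>+x. indicator ?B x \<partial>\<mu>)"
        by (rule nn_integral_coordinate) measurable
      finally show ?thesis .
    qed
    have "(\<integral>\<^sup>+x. (h x - 1) * indicator ?B x \<partial>\<mu>) = (\<integral>\<^sup>+x. h x * indicator ?B x - indicator ?B x \<partial>\<mu>)"
      by (intro nn_integral_cong) (auto split: split_indicator)
    also have "\<dots> = (\<integral>\<^sup>+x. h x * indicator ?B x \<partial>\<mu>) - (\<integral>\<^sup>+x. indicator ?B x \<partial>\<mu>)"
      by (intro nn_integral_diff) (auto split: split_indicator simp: emeasure_eq_measure)
    also have "\<dots> = 0" using h_le by (simp add: diff_eq_0_iff_ennreal emeasure_eq_measure le_less_trans[OF _ ennreal_less_top])
    finally have "AE x in \<mu>. (h x - 1) * indicator ?B x = 0"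
      by (subst (asm) nn_integral_0_iff_AE) auto
    then have "AE x in \<mu>. x \<notin> ?B"
      by eventually_elim (auto split: split_indicator_asm simp: diff_eq_0_iff_ennreal)
    then show "?B \<in> null_sets \<mu>"
      by (subst (asm) AE_iff_null_sets[symmetric]) auto
  qed auto
  \<comment> \<open>Truncation produces a real-valued version whose bounds hold everywhere rather
    than almost everywhere.\<close>
  define h' where "h' x = enn2real (min 1 (h x))" for x
  have [measurable]: "h' \<in> borel_measurable \<mu>" unfolding h'_def by measurable
  have h'_bound: "0 \<le> h' x \<and> h' x \<le> 1" for x
    unfolding h'_def using enn2real_mono[of "min 1 (h x)" 1] by simp
  have h'_eq: "AE x in \<mu>. ennreal (h' x) = h x"
    using \<open>AE x in \<mu>. h x \<le> 1\<close>
    by eventually_elim (auto simp: h'_def min_absorb2 intro!: ennreal_enn2real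
        le_less_trans[OF _ ennreal_one_less_top])
  show ?thesis
  proof (rule that[of h'])
    fix n W assume W: "W \<in> borel_measurable (past (Suc n))"
      and fin: "(\<integral>\<^sup>+\<omega>. W (restrict \<omega> {0..<Suc n}) \<partial>path_law) < \<infinity>"
    have "(\<lambda>\<omega>. W (restrict \<omega> {0..<Suc n})) \<in> borel_measurable path_space"
      by (rule measurable_compose[OF measurable_restrict_past W])
    from ex_law_weight[OF this fin, of n] obtain k where k[measurable]: "k \<in> borel_measurable \<mu>"
      and k_eq: "\<And>f. f \<in> borel_measurable \<mu> \<Longrightarrow>
        (\<integral>\<^sup>+\<omega>. W (restrict \<omega> {0..<Suc n}) * f (\<omega> n) \<partial>path_law) = (\<integral>\<^sup>+x. k x * f x \<partial>\<mu>)" by auto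
    have "(\<integral>\<^sup>+\<omega>. W (restrict \<omega> {0..<Suc n}) * indicator A \<omega> \<partial>path_law) =
      (\<integral>\<^sup>+\<omega>. W (restrict \<omega> {0..<Suc n}) * indicator A (\<lambda>i. \<omega> (n + i)) \<partial>path_law)"
      using shift_invariant_tail[OF inv] by (intro nn_integral_cong) (auto split: split_indicator)
    also have "\<dots> = (\<integral>\<^sup>+\<omega>. k (\<omega> 0) * indicator A \<omega> \<partial>path_law)"
      by (rule markov_property[OF W fin k k_eq A])
    also have "\<dots> = (\<integral>\<^sup>+x. h x * k x \<partial>\<mu>)"
      using h_eq[OF k] by (simp add: mult.commute)
    also have "\<dots> = (\<integral>\<^sup>+x. k x * ennreal (h' x) \<partial>\<mu>)"
      using h'_eq by (intro nn_integral_cong_AE) (auto simp: mult.commute)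
    also have "\<dots> = (\<integral>\<^sup>+\<omega>. W (restrict \<omega> {0..<Suc n}) * ennreal (h' (\<omega> n)) \<partial>path_law)"
      by (rule k_eq[symmetric]) simp
    finally show "(\<integral>\<^sup>+\<omega>. W (restrict \<omega> {0..<Suc n}) * indicator A \<omega> \<partial>path_law) =
      (\<integral>\<^sup>+\<omega>. W (restrict \<omega> {0..<Suc n}) * ennreal (h' (\<omega> n)) \<partial>path_law)" .
  qed (use h'_bound in auto)
qed

text \<open>A bounded harmonic function is a martingale along the stationary chain with constant second
  moment, so its increments vanish.\<close>

lemma harmonic_constant_along_steps:
  fixes h :: "'a \<Rightarrow> real"
  assumes h[measurable]: "h \<in> borel_measurable \<mu>" and bounds: "\<And>x. 0 \<le> h x" "\<And>x. h x \<le> 1"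
    and harmonic: "AE x in \<mu>. (\<integral>\<^sup>+y. ennreal (h y) \<partial>P x) = ennreal (h x)"
  shows "AE x in \<mu>. AE y in P x. h y = h x"
proof -
  \<comment> \<open>The expanded square keeps its cross term on the left, because subtraction in
    \<open>ennreal\<close> is truncated.\<close>
  have nn: "(\<integral>\<^sup>+y. ennreal ((h y - h x)\<^sup>2) \<partial>P x) + 2 * ennreal (h x) * (\<integral>\<^sup>+y. ennreal (h y) \<partial>P x) =
      (\<integral>\<^sup>+y. ennreal ((h y)\<^sup>2) \<partial>P x) + ennreal ((h x)\<^sup>2)" if x: "x \<in> space \<mu>" for x
  proof -
    interpret Px: prob_space "P x" by (rule prob_space_kernel[OF x])
    have [measurable]: "h \<in> borel_measurable (P x)"
      using h sets_kernel[OF x] by (simp add: measurable_cong_sets[OF sets_kernel[OF x] refl])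
    have "(\<integral>\<^sup>+y. ennreal ((h y - h x)\<^sup>2) \<partial>P x) + 2 * ennreal (h x) * (\<integral>\<^sup>+y. ennreal (h y) \<partial>P x) =
      (\<integral>\<^sup>+y. ennreal ((h y - h x)\<^sup>2) + 2 * ennreal (h x) * ennreal (h y) \<partial>P x)"
      by (simp add: nn_integral_add nn_integral_cmult)
    also have "\<dots> = (\<integral>\<^sup>+y. ennreal ((h y)\<^sup>2) + ennreal ((h x)\<^sup>2) \<partial>P x)"
    proof (intro nn_integral_cong)
      fix y
      have "2 * ennreal (h x) * ennreal (h y) = ennreal (2 * h x * h y)"
        using bounds by (simp add: ennreal_mult' ennreal_mult'')
      moreover have "(h y - h x)\<^sup>2 + 2 * h x * h y = (h y)\<^sup>2 + (h x)\<^sup>2"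
        by (simp add: power2_eq_square algebra_simps)
      ultimately show "ennreal ((h y - h x)\<^sup>2) + 2 * ennreal (h x) * ennreal (h y) = ennreal ((h y)\<^sup>2) + ennreal ((h x)\<^sup>2)"
        using bounds[of x] bounds[of y]
        by (metis ennreal_plus mult_nonneg_nonneg zero_le_numeral zero_le_power2)
    qed
    also have "\<dots> = (\<integral>\<^sup>+y. ennreal ((h y)\<^sup>2) \<partial>P x) + ennreal ((h x)\<^sup>2)"
      by (simp add: nn_integral_add Px.emeasure_space_1)
    finally show ?thesis .
  qed
  define D where "D x = (\<integral>\<^sup>+y. ennreal ((h y - h x)\<^sup>2) \<partial>P x)" for x
  have D[measurable]: "D \<in> borel_measurable \<mu>"
    unfolding D_def by (rule nn_integral_measurable_subprob_algebra2[where N=\<mu>]) measurable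
  define S where "S = (\<integral>\<^sup>+x. ennreal ((h x)\<^sup>2) \<partial>\<mu>)"
  have "(\<integral>\<^sup>+x. D x \<partial>\<mu>) + (S + S) = (\<integral>\<^sup>+x. D x + (ennreal ((h x)\<^sup>2) + ennreal ((h x)\<^sup>2)) \<partial>\<mu>)"
    unfolding S_def by (simp add: nn_integral_add)
  also have "\<dots> = (\<integral>\<^sup>+x. (\<integral>\<^sup>+y. ennreal ((h y)\<^sup>2) \<partial>P x) + ennreal ((h x)\<^sup>2) \<partial>\<mu>)"
  proof (intro nn_integral_cong_AE)
    show "AE x in \<mu>. D x + (ennreal ((h x)\<^sup>2) + ennreal ((h x)\<^sup>2)) = (\<integral>\<^sup>+y. ennreal ((h y)\<^sup>2) \<partial>P x) + ennreal ((h x)\<^sup>2)"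
      using harmonic AE_space
    proof eventually_elim
      case (elim x)
      have "ennreal ((h x)\<^sup>2) + ennreal ((h x)\<^sup>2) = 2 * ennreal (h x) * ennreal (h x)"
        using bounds[of x] by (simp add: power2_eq_square ennreal_mult' mult_2 distrib_right)
      with nn[OF elim(2)] elim(1) show ?case by (simp add: D_def)
    qed
  qed
  also have "\<dots> = S + S"
    unfolding S_def using nn_integral_invariant[of "\<lambda>x. ennreal ((h x)\<^sup>2)"] by (simp add: nn_integral_add)
  finally have "(\<integral>\<^sup>+x. D x \<partial>\<mu>) + (S + S) = 0 + (S + S)" by simp
  moreover have "S \<le> (\<integral>\<^sup>+x. 1 \<partial>\<mu>)"
    unfolding S_def using bounds by (intro nn_integral_mono) (auto simp: ennreal_le_1 power_le_one)
  \<comment> \<open>Only a finite second moment can be cancelled in \<open>ennreal\<close>;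
    boundedness of \<open>h\<close> provides this.\<close>
  then have "S + S \<noteq> \<infinity>" by (auto simp: emeasure_space_1 top_unique)
  ultimately have "(\<integral>\<^sup>+x. D x \<partial>\<mu>) = 0" by (metis ennreal_add_left_cancel add.commute infinity_ennreal_def)
  then have "AE x in \<mu>. D x = 0" by (subst (asm) nn_integral_0_iff_AE) auto
  then show ?thesis
    using AE_space
  proof eventually_elim
    case (elim x)
    have [measurable]: "h \<in> borel_measurable (P x)"
      using h sets_kernel[OF elim(2)] by (simp add: measurable_cong_sets[OF sets_kernel[OF elim(2)] refl])
    from elim(1) have "AE y in P x. ennreal ((h y - h x)\<^sup>2) = 0"
      unfolding D_def by (subst (asm) nn_integral_0_iff_AE) auto
    then show ?case by eventually_elim (simp add: ennreal_eq_0_iff)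
  qed
qed

text \<open>The hypothesis concerns single transitions only. It can be applied to the conditional
  probability of an invariant event because \<open>harmonic_constant_along_steps\<close> shows that
  this function does not change along a step.\<close>

theorem markov_ergodicI:
  assumes irreducible: "\<And>h :: 'a \<Rightarrow> real. h \<in> borel_measurable \<mu> \<Longrightarrow> AE x in \<mu>. AE y in P x. h y = h x \<Longrightarrow>
    \<exists>c. AE x in \<mu>. h x = c"
  shows "markov_ergodic \<mu> P"
  unfolding markov_ergodic_def
proof (intro ballI impI)
  fix A assume A[measurable]: "A \<in> sets path_space" and inv: "shift -` A \<inter> space path_space = A"
  interpret Q: prob_space path_law by (rule prob_space_path_law)
  from ex_invariant_density[OF A inv] obtain h where h[measurable]: "h \<in> borel_measurable \<mu>"
    and bounds: "\<And>x. 0 \<le> h x" "\<And>x. h x \<le> 1"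
    and h_eq: "\<And>n W. W \<in> borel_measurable (past (Suc n)) \<Longrightarrow>
      (\<integral>\<^sup>+\<omega>. W (restrict \<omega> {0..<Suc n}) \<partial>path_law) < \<infinity> \<Longrightarrow>
      (\<integral>\<^sup>+\<omega>. W (restrict \<omega> {0..<Suc n}) * indicator A \<omega> \<partial>path_law) =
      (\<integral>\<^sup>+\<omega>. W (restrict \<omega> {0..<Suc n}) * ennreal (h (\<omega> n)) \<partial>path_law)"
    by (rule ex_invariant_density[OF A inv]) blast
  have "AE x in \<mu>. (\<integral>\<^sup>+y. ennreal (h y) \<partial>P x) = ennreal (h x)"
  proof (rule density_unique_finite_measure)
    fix B assume B: "B \<in> sets \<mu>"
    \<comment> \<open>Harmonicity is tested on sets \<open>B\<close> of starting points. The
      indicator of \<open>B\<close> at time 0 is an admissible past weight at times 0 and 1 alike,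
      so \<open>h\<close> at either time integrates to the probability of \<open>A\<close> with
      start in \<open>B\<close>.\<close>
    define W :: "(nat \<Rightarrow> 'a) \<Rightarrow> ennreal" where "W \<omega> = indicator B (\<omega> 0)" for \<omega>
    have W: "W \<in> borel_measurable (past (Suc n))" for n
      unfolding W_def by (rule measurable_compose[of _ _ \<mu>])
        (use B in \<open>auto intro!: measurable_component_singleton\<close>)
    have W_restrict: "W (restrict \<omega> {0..<Suc n}) = indicator B (\<omega> 0)" for \<omega> n
      by (simp add: W_def)
    have fin: "(\<integral>\<^sup>+\<omega>. W (restrict \<omega> {0..<Suc n}) \<partial>path_law) < \<infinity>" for n
    proof -
      have "(\<integral>\<^sup>+\<omega>. W (restrict \<omega> {0..<Suc n}) \<partial>path_law) = emeasure \<mu> B"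
        unfolding W_restrict using nn_integral_coordinate[of "indicator B" 0] B by simp
      then show ?thesis by (simp add: emeasure_eq_measure)
    qed
    have "(\<integral>\<^sup>+x. (\<integral>\<^sup>+y. ennreal (h y) \<partial>P x) * indicator B x \<partial>\<mu>) =
      (\<integral>\<^sup>+\<omega>. (\<integral>\<^sup>+y. ennreal (h y) \<partial>P (\<omega> 0)) * indicator B (\<omega> 0) \<partial>path_law)"
      by (rule nn_integral_coordinate[symmetric]) (use B in measurable)
    also have "\<dots> = (\<integral>\<^sup>+\<omega>. W (restrict \<omega> {0..<Suc 0}) * (\<integral>\<^sup>+y. ennreal (h y) \<partial>P (\<omega> 0)) \<partial>path_law)"
      unfolding W_restrict by (simp add: mult.commute)
    also have "\<dots> = (\<integral>\<^sup>+\<omega>. W (restrict \<omega> {0..<Suc 0}) * ennreal (h (\<omega> (Suc 0))) \<partial>path_law)"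
      by (rule nn_integral_markov_step[symmetric, OF W]) simp
    also have "\<dots> = (\<integral>\<^sup>+\<omega>. W (restrict \<omega> {0..<Suc 0}) * ennreal (h (\<omega> 0)) \<partial>path_law)"
      using h_eq[OF W fin, of 0] h_eq[OF W fin, of 1] unfolding W_restrict by simp
    also have "\<dots> = (\<integral>\<^sup>+x. ennreal (h x) * indicator B x \<partial>\<mu>)"
      unfolding W_restrict using nn_integral_coordinate[of "\<lambda>x. indicator B x * ennreal (h x)" 0] B
      by (simp add: mult.commute)
    finally show "(\<integral>\<^sup>+x. (\<integral>\<^sup>+y. ennreal (h y) \<partial>P x) * indicator B x \<partial>\<mu>) =
      (\<integral>\<^sup>+x. ennreal (h x) * indicator B x \<partial>\<mu>)" .
  qed simp_all
  from irreducible[OF h harmonic_constant_along_steps[OF h bounds this]]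
  obtain c where c: "AE x in \<mu>. h x = c" by auto
  have "AE x in \<mu>. 0 \<le> c \<and> c \<le> 1"
    using c by eventually_elim (use bounds in blast)
  \<comment> \<open>A statement free of \<open>x\<close> that holds almost everywhere for a
    probability measure is true.\<close>
  then have c_bounds: "0 \<le> c" "c \<le> 1" by simp_all
  have density_A: "emeasure (density path_law (indicator A)) E = emeasure path_law (A \<inter> E)"
    if "E \<in> sets path_space" for E
    using that by (simp add: emeasure_density indicator_inter_arith[symmetric])
  \<comment> \<open>Once \<open>h\<close> is the constant \<open>c\<close>, restricting the path law
    to \<open>A\<close> scales the mass of every cylinder by \<open>c\<close>, hence scales the
    whole measure.\<close>
  have "density path_law (indicator A) = density path_law (\<lambda>_. ennreal c)"
  proof (rule path_measure_eqI)
    show "finite_measure (density path_law (indicator A))"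
      by (intro finite_measureI) (simp add: density_A Q.emeasure_eq_measure)
    fix B :: "nat \<Rightarrow> 'a set" and k assume B[measurable]: "\<And>i. B i \<in> sets \<mu>"
    define W :: "(nat \<Rightarrow> 'a) \<Rightarrow> ennreal" where "W \<omega> = (\<Prod>i\<le>k. indicator (B i) (\<omega> i))" for \<omega>
    have "(\<lambda>\<omega>. indicator (B i) (\<omega> i) :: ennreal) \<in> borel_measurable (past (Suc k))" if "i \<le> k" for i
      by (rule measurable_compose[of _ _ \<mu>]) (use that in \<open>auto intro!: measurable_component_singleton\<close>)
    then have W: "W \<in> borel_measurable (past (Suc k))"
      unfolding W_def by (intro borel_measurable_prod_ennreal) auto
    have W_restrict: "W (restrict \<omega> {0..<Suc k}) = W \<omega>" for \<omega>
      unfolding W_def by (intro prod.cong) auto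
    have W'[measurable]: "W \<in> borel_measurable path_law"
      using measurable_compose[OF measurable_restrict_past W] by (simp add: W_restrict)
    have "(\<integral>\<^sup>+\<omega>. W \<omega> \<partial>path_law) \<le> (\<integral>\<^sup>+\<omega>. 1 \<partial>path_law)"
      unfolding W_def by (intro nn_integral_mono prod_le_1) (auto split: split_indicator)
    then have fin: "(\<integral>\<^sup>+\<omega>. W (restrict \<omega> {0..<Suc k}) \<partial>path_law) < \<infinity>"
      by (simp add: W_restrict Q.emeasure_space_1[simplified] le_less_trans[OF _ ennreal_one_less_top])
    have "(\<integral>\<^sup>+\<omega>. W \<omega> \<partial>density path_law (indicator A)) = (\<integral>\<^sup>+\<omega>. W \<omega> * indicator A \<omega> \<partial>path_law)"
      by (subst nn_integral_density) (simp_all add: mult.commute)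
    also have "\<dots> = (\<integral>\<^sup>+\<omega>. W \<omega> * ennreal (h (\<omega> k)) \<partial>path_law)"
      using h_eq[OF W fin] unfolding W_restrict .
    also have "\<dots> = (\<integral>\<^sup>+\<omega>. W \<omega> * ennreal c \<partial>path_law)"
      using AE_coordinate[OF c, of k] by (intro nn_integral_cong_AE) auto
    also have "\<dots> = (\<integral>\<^sup>+\<omega>. W \<omega> \<partial>density path_law (\<lambda>_. ennreal c))"
      by (subst nn_integral_density) (simp_all add: mult.commute)
    finally show "(\<integral>\<^sup>+\<omega>. (\<Prod>i\<le>k. indicator (B i) (\<omega> i)) \<partial>density path_law (indicator A)) =
        (\<integral>\<^sup>+\<omega>. (\<Prod>i\<le>k. indicator (B i) (\<omega> i)) \<partial>density path_law (\<lambda>_. ennreal c))"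
      unfolding W_def .
  qed simp_all
  then have "emeasure (density path_law (indicator A)) E = emeasure (density path_law (\<lambda>_. ennreal c)) E" for E
    by simp
  then have A_indep: "emeasure path_law (A \<inter> E) = ennreal c * emeasure path_law E" if "E \<in> sets path_space" for E
    using that density_A[OF that] by (simp add: emeasure_density_const)
  have "emeasure path_law A = ennreal c"
    using A_indep[of "space path_space"] sets.sets_into_space[OF A] Q.emeasure_space_1 by (simp add: Int_absorb2)
  moreover from this have "ennreal c = ennreal c * ennreal c"
    using A_indep[OF A] by simp
  then have "c = c * c" using c_bounds by (simp add: ennreal_mult'[symmetric])
  then have "c = 0 \<or> c = 1" by auto
  ultimately show "emeasure path_law A = 0 \<or> emeasure path_law A = 1" by auto
qed

end

section \<open>The circular billiard map\<close>

lemma frac_add_of_int: "frac (x + of_int n) = frac x"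
  by (simp add: frac_def)

lemma cis_eq_imp_frac_eq:
  assumes "cis a = cis b"
  shows "frac (a / (2 * pi)) = frac (b / (2 * pi))"
proof -
  have "sin a = sin b" "cos a = cos b"
    using assms by (auto simp: complex_eq_iff)
  then obtain n :: int where "a = b + 2 * pi * n"
    by (metis sin_cos_eq_iff)
  then have "a / (2 * pi) = b / (2 * pi) + of_int n" by (simp add: field_simps)
  then show ?thesis by (simp only: frac_add_of_int)
qed

lemma cis_frac: "cis (2 * pi * frac t) = cis (2 * pi * t)"
proof -
  have "2 * pi * t = 2 * pi * frac t + 2 * pi * of_int \<lfloor>t\<rfloor>"
    by (simp add: frac_def algebra_simps)
  then show ?thesis
    by (simp add: cis_mult[symmetric])
qed

definition transvection :: "real \<Rightarrow> real^2^2" where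
  "transvection a = vector [vector [1, a], vector [0, 1]]"

lemma transvection_0: "transvection 0 = mat 1"
  by (simp add: transvection_def vec_eq_iff forall_2 mat_def)

locale circular_billiard =
  fixes R :: real
  assumes R_pos: "R > 0"
begin

section \<open>Geometry of a single chord\<close>

lemma perimeter_pos: "perimeter R > 0"
  using R_pos by (simp add: perimeter_def)

text \<open>With reflection angle \<phi> = \<open>arcsin s\<close>, the chord spans the central
  angle \<open>pi - 2 * \<phi>\<close>; the factor \<open>R\<close> converts it to
  arclength.\<close>

definition rotation :: "real \<Rightarrow> real" where
  "rotation s = R * (pi - 2 * arcsin s)"

definition chord_map :: "real \<times> real \<Rightarrow> real \<times> real" where
  "chord_map x = (perimeter R * frac ((fst x + rotation (snd x)) / perimeter R), snd x)"

text \<open>The squared distance from the centre along the ray exceeds \<open>R\<^sup>2\<close> by a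
  quadratic in \<open>t\<close> with roots 0 and \<open>2 * R * cos \<phi>\<close>. Strictly between
  them the particle is inside the disc, and the second root is the flight time.\<close>

lemma norm_chord: "norm (of_real R * cis \<theta> - t *\<^sub>R cis (\<theta> - \<phi>)) ^ 2 = R\<^sup>2 + t * (t - 2 * R * cos \<phi>)"
proof -
  have "of_real R * cis \<theta> - t *\<^sub>R cis (\<theta> - \<phi>) = cis \<theta> * (of_real R - of_real t * cis (- \<phi>))"
    by (simp add: scaleR_conv_of_real algebra_simps cis_mult)
  then have "norm (of_real R * cis \<theta> - t *\<^sub>R cis (\<theta> - \<phi>)) = norm (of_real R - of_real t * cis (- \<phi>))"
    by (simp add: norm_mult)
  also have "\<dots> ^ 2 = (R - t * cos \<phi>)\<^sup>2 + (t * sin \<phi>)\<^sup>2"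
    by (simp add: cmod_power2)
  also have "\<dots> = R\<^sup>2 + t * (t * ((cos \<phi>)\<^sup>2 + (sin \<phi>)\<^sup>2) - 2 * R * cos \<phi>)"
    by algebra
  finally show ?thesis by (simp only: sin_cos_squared_add2 mult_1_right)
qed

text \<open>Writing \<open>2 * cos \<phi>\<close> as \<open>cis \<phi> + cis (- \<phi>)\<close>
  splits the displacement into two vectors of length \<open>R\<close>, the first of which cancels
  the starting point.\<close>

lemma chord_end: "of_real R * cis \<theta> - (2 * R * cos \<phi>) *\<^sub>R cis (\<theta> - \<phi>) = of_real R * cis (\<theta> + pi - 2 * \<phi>)"
  (is "?l = ?r")
proof -
  have "complex_of_real (2 * cos \<phi>) = cis \<phi> + cis (- \<phi>)"
    by (simp add: complex_eq_iff)
  then have "(2 * R * cos \<phi>) *\<^sub>R cis (\<theta> - \<phi>) = of_real R * ((cis \<phi> + cis (- \<phi>)) * cis (\<theta> - \<phi>))"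
    by (simp add: scaleR_conv_of_real mult_ac)
  also have "(cis \<phi> + cis (- \<phi>)) * cis (\<theta> - \<phi>) = cis \<theta> + cis (\<theta> - 2 * \<phi>)"
    by (simp add: distrib_right cis_mult)
  also have "cis (\<theta> - 2 * \<phi>) = - cis (\<theta> + pi - 2 * \<phi>)"
    by (simp add: complex_eq_iff sin_diff cos_diff sin_add cos_add)
  finally show ?thesis by (simp add: algebra_simps)
qed

text \<open>The vector \<open>cis (\<theta> - 2 * \<phi>)\<close> is the inward normal at the end of
  the chord. The reflected velocity lags behind it by \<phi> again, which is why \<open>s\<close> is
  conserved.\<close>

lemma reflect_chord: "reflect (cis (\<theta> - 2 * \<phi>)) (- cis (\<theta> - \<phi>)) = cis (\<theta> - 3 * \<phi>)"
proof -
  have "(- cis (\<theta> - \<phi>)) \<bullet> cis (\<theta> - 2 * \<phi>) = - cos \<phi>"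
  proof -
    have "cos (\<theta> - \<phi>) * cos (\<theta> - 2 * \<phi>) + sin (\<theta> - \<phi>) * sin (\<theta> - 2 * \<phi>) = cos ((\<theta> - \<phi>) - (\<theta> - 2 * \<phi>))"
      by (rule cos_diff[symmetric])
    then show ?thesis by (simp add: inner_complex_def)
  qed
  then have "reflect (cis (\<theta> - 2 * \<phi>)) (- cis (\<theta> - \<phi>)) = - cis (\<theta> - \<phi>) + of_real (2 * cos \<phi>) * cis (\<theta> - 2 * \<phi>)"
    by (simp add: reflect_def scaleR_conv_of_real)
  also have "complex_of_real (2 * cos \<phi>) = cis \<phi> + cis (- \<phi>)"
    by (simp add: complex_eq_iff)
  finally show ?thesis
    by (simp add: distrib_right cis_mult)
qed

lemma arcsin_range: "arcsin s \<in> {- pi / 2..pi / 2}" if "\<bar>s\<bar> \<le> 1"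
  using arcsin_bounded[of s] that by auto

lemma post_velocity_iff:
  assumes "\<bar>s\<bar> \<le> 1"
  shows "post_velocity R (r, s) v \<longleftrightarrow> v = - cis (r / R - arcsin s)"
proof
  assume "post_velocity R (r, s) v"
  then obtain \<phi> where \<phi>: "- pi / 2 \<le> \<phi>" "\<phi> \<le> pi / 2" "s = sin \<phi>" "- cis (r / R) = cis \<phi> * v"
    unfolding post_velocity_def inward_normal_def by auto
  have "arcsin s = \<phi>" using \<phi> by (simp add: arcsin_sin)
  moreover have "v = cis (- \<phi>) * (cis \<phi> * v)" by (simp add: mult.assoc[symmetric] cis_mult)
  then have "v = - cis (r / R - \<phi>)"
    unfolding \<phi>(4)[symmetric] by (simp add: cis_mult)
  ultimately show "v = - cis (r / R - arcsin s)" by simp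
next
  assume "v = - cis (r / R - arcsin s)"
  then show "post_velocity R (r, s) v"
    using assms arcsin_range[OF assms]
    by (auto simp: post_velocity_def inward_normal_def cis_mult intro!: bexI[of _ "arcsin s"])
qed

lemma chord_map_in_collision_space:
  assumes "\<bar>snd x\<bar> \<le> 1"
  shows "chord_map x \<in> collision_space R"
  using assms perimeter_pos frac_lt_1[of "(fst x + rotation (snd x)) / perimeter R"]
  by (auto simp: chord_map_def collision_space_def frac_ge_0)

lemma angle_chord_map: "cis (fst (chord_map (r, s)) / R) = cis (r / R + pi - 2 * arcsin s)"
proof -
  have "fst (chord_map (r, s)) / R = 2 * pi * frac ((r + rotation s) / perimeter R)"
    using R_pos by (simp add: chord_map_def perimeter_def)
  also have "cis \<dots> = cis (2 * pi * ((r + rotation s) / perimeter R))"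
    by (rule cis_frac)
  also have "2 * pi * ((r + rotation s) / perimeter R) = r / R + pi - 2 * arcsin s"
    using R_pos by (simp add: perimeter_def rotation_def field_simps)
  finally show ?thesis .
qed

lemma next_collision_chord_map:
  assumes "\<bar>s\<bar> < 1"
  shows "next_collision R (r, s) (chord_map (r, s))"
  unfolding next_collision_def
proof (intro conjI exI[of _ "- cis (r / R - arcsin s)"] exI[of _ "2 * R * cos (arcsin s)"] ballI)
  have s: "\<bar>s\<bar> \<le> 1" using assms by simp
  show "chord_map (r, s) \<in> collision_space R"
    using chord_map_in_collision_space s by simp
  show "post_velocity R (r, s) (- cis (r / R - arcsin s))"
    using post_velocity_iff[OF s] by simp
  have "cos (arcsin s) > 0"
    using assms arcsin_lt_bounded[of s] by (intro cos_gt_zero_pi) auto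
  then show pos: "2 * R * cos (arcsin s) > 0" using R_pos by simp
  show "bdry R (fst (r, s)) + t' *\<^sub>R (- cis (r / R - arcsin s)) \<in> ball 0 R"
    if "t' \<in> {0<..<2 * R * cos (arcsin s)}" for t'
  proof -
    have "(norm (of_real R * cis (r / R) - t' *\<^sub>R cis (r / R - arcsin s)))\<^sup>2 < R\<^sup>2"
      unfolding norm_chord using that by (simp add: mult_less_0_iff)
    then have "norm (of_real R * cis (r / R) - t' *\<^sub>R cis (r / R - arcsin s)) < R"
      by (rule power2_less_imp_less) (use R_pos in simp)
    then show ?thesis by (simp add: bdry_def)
  qed
  show "bdry R (fst (r, s)) + (2 * R * cos (arcsin s)) *\<^sub>R (- cis (r / R - arcsin s)) = bdry R (fst (chord_map (r, s)))"
    using chord_end[of "r / R" "arcsin s"] by (simp add: bdry_def angle_chord_map)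
  have normal: "inward_normal R (fst (chord_map (r, s))) = cis (r / R - 2 * arcsin s)"
    unfolding inward_normal_def angle_chord_map
    by (simp add: complex_eq_iff sin_diff cos_diff sin_add cos_add)
  show "post_velocity R (chord_map (r, s)) (reflect (inward_normal R (fst (chord_map (r, s)))) (- cis (r / R - arcsin s)))"
    unfolding normal reflect_chord
    using s arcsin_range[OF s] normal
    by (auto simp: post_velocity_def chord_map_def cis_mult intro!: bexI[of _ "arcsin s"])
qed

text \<open>Arrival on the circle forces the flight time to be the nonzero root
  \<open>2 * R * cos \<phi>\<close>. Its positivity rules out tangential collisions, where the
  cosine vanishes, and the outgoing angle follows by cancelling the common phase in the reflected
  velocity.\<close>

lemma next_collision_unique:
  assumes s: "\<bar>s\<bar> \<le> 1" and y: "next_collision R (r, s) y"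
  shows "\<bar>s\<bar> < 1 \<and> y = chord_map (r, s)"
proof -
  define \<phi> where "\<phi> = arcsin s"
  have \<phi>: "- pi / 2 \<le> \<phi>" "\<phi> \<le> pi / 2" using arcsin_range[OF s] by (auto simp: \<phi>_def)
  obtain r' s' where y_eq: "y = (r', s')" by (cases y)
  from y obtain v t where v: "post_velocity R (r, s) v" and t: "t > 0"
    and hit: "bdry R r + t *\<^sub>R v = bdry R r'"
    and post: "post_velocity R (r', s') (reflect (inward_normal R r') v)" and mem: "(r', s') \<in> collision_space R"
    unfolding next_collision_def y_eq by auto
  have v_eq: "v = - cis (r / R - \<phi>)" using v post_velocity_iff[OF s] by (simp add: \<phi>_def)
  have hit': "of_real R * cis (r / R) - t *\<^sub>R cis (r / R - \<phi>) = of_real R * cis (r' / R)"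
    using hit by (simp add: v_eq bdry_def)
  then have "(norm (of_real R * cis (r / R) - t *\<^sub>R cis (r / R - \<phi>)))\<^sup>2 = R\<^sup>2"
    by (simp add: norm_mult)
  then have t_eq: "t = 2 * R * cos \<phi>"
    unfolding norm_chord using t by simp
  with t R_pos have "cos \<phi> > 0" by (simp add: zero_less_mult_iff)
  then have "cos \<phi> \<noteq> 0" by simp
  have s_lt: "\<bar>s\<bar> < 1"
  proof (rule ccontr)
    assume "\<not> \<bar>s\<bar> < 1"
    then have "s = 1 \<or> s = -1" using s by auto
    then show False using \<open>cos \<phi> \<noteq> 0\<close> by (auto simp: \<phi>_def)
  qed
  have "of_real R * cis (r' / R) = of_real R * cis (r / R + pi - 2 * \<phi>)"
    using hit' chord_end[of "r / R" \<phi>] unfolding t_eq by metis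
  then have cis_r': "cis (r' / R) = cis (r / R + pi - 2 * \<phi>)" using R_pos by simp
  \<comment> \<open>The boundary point determines arclength only modulo the perimeter; the half-open
    fundamental domain then selects the representative.\<close>
  have "frac (r' / perimeter R) = frac ((r + rotation s) / perimeter R)"
    using cis_eq_imp_frac_eq[OF cis_r'] R_pos
    by (simp add: perimeter_def rotation_def \<phi>_def field_simps)
  moreover have "frac (r' / perimeter R) = r' / perimeter R"
    using mem perimeter_pos by (intro frac_eq[THEN iffD2]) (auto simp: collision_space_def)
  ultimately have r'_eq: "r' = fst (chord_map (r, s))"
    using perimeter_pos by (simp add: chord_map_def field_simps)
  have normal: "inward_normal R r' = cis (r / R - 2 * \<phi>)"
    unfolding inward_normal_def cis_r' by (simp add: complex_eq_iff sin_diff cos_diff sin_add cos_add)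
  have s': "\<bar>s'\<bar> \<le> 1" using mem by (auto simp: collision_space_def)
  have "cis (r / R - 3 * \<phi>) = - cis (r' / R - arcsin s')"
    using post unfolding normal v_eq reflect_chord using post_velocity_iff[OF s'] by simp
  also have "\<dots> = - (cis (r' / R) * cis (- arcsin s'))" by (simp add: cis_mult)
  also have "\<dots> = cis (r / R - 2 * \<phi>) * cis (- arcsin s')"
    using normal by (metis inward_normal_def mult_minus_left)
  also have "\<dots> = cis (r / R - 2 * \<phi> - arcsin s')" by (simp add: cis_mult)
  finally have "cis (- (r / R - 2 * \<phi>)) * cis (r / R - 3 * \<phi>) = cis (- (r / R - 2 * \<phi>)) * cis (r / R - 2 * \<phi> - arcsin s')"
    by simp
  then have "cis (- \<phi>) = cis (- arcsin s')" by (simp add: cis_mult)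
  then have "sin \<phi> = sin (arcsin s')" by (simp add: complex_eq_iff)
  then have "s' = s" using s s' by (simp add: \<phi>_def sin_arcsin abs_le_iff)
  then have "y = chord_map (r, s)" using r'_eq by (simp add: y_eq chord_map_def)
  with s_lt show ?thesis by blast
qed

text \<open>Stated on the whole plane, because \<open>jacobian_matrix\<close> differentiates in full
  neighbourhoods. Outside the open strip no next collision exists: a tangential flight would have
  length 0, and beyond the strip \<open>s\<close> is not a sine.\<close>

lemma billiard_map_eq: "billiard_map R x = (if \<bar>snd x\<bar> < 1 then chord_map x else x)"
proof (cases x)
  case (Pair r s)
  show ?thesis
  proof (cases "\<bar>s\<bar> < 1")
    case True
    then have "(THE y. next_collision R (r, s) y) = chord_map (r, s)"
      using next_collision_chord_map next_collision_unique[of s r] by (intro the_equality) auto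
    moreover have "\<exists>y. next_collision R (r, s) y" using next_collision_chord_map[OF True] by blast
    ultimately have "billiard_map R (r, s) = chord_map (r, s)"
      unfolding billiard_map_def by metis
    then show ?thesis using True Pair by simp
  next
    case False
    have "\<not> next_collision R (r, s) y" for y
    proof
      assume y: "next_collision R (r, s) y"
      then obtain v where "post_velocity R (r, s) v"
        unfolding next_collision_def by blast
      then obtain \<phi> where "s = sin \<phi>" by (auto simp: post_velocity_def)
      then have "\<bar>s\<bar> \<le> 1" by simp
      from next_collision_unique[OF this y] False show False by simp
    qed
    then have "billiard_map R (r, s) = (r, s)"
      unfolding billiard_map_def by metis
    then show ?thesis using False Pair by simp
  qed
qed

section \<open>Where the billiard map is differentiable\<close>

definition shear :: "real \<Rightarrow> real" where
  "shear s = - 2 * R / sqrt (1 - s\<^sup>2)"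

text \<open>The second condition keeps the image off the seam \<open>r = 0\<close>, where
  \<open>frac\<close> jumps. Within the collision space these turn out to be exactly the points of
  differentiability.\<close>

definition regular :: "real \<times> real \<Rightarrow> bool" where
  "regular x \<longleftrightarrow> \<bar>snd x\<bar> < 1 \<and> (fst x + rotation (snd x)) / perimeter R \<notin> \<int>"

lemma rotation_has_derivative: "\<bar>s\<bar> < 1 \<Longrightarrow> (rotation has_real_derivative shear s) (at s)"
  unfolding rotation_def[abs_def] shear_def
  by (auto intro!: derivative_eq_intros simp: field_simps)

text \<open>Off the seam the integer part removed by \<open>frac\<close> is locally constant, so
  near such a point the map is the shear up to a fixed translation.\<close>

lemma billiard_map_has_derivative:
  assumes "regular x"
  shows "(billiard_map R has_derivative (\<lambda>k. (fst k + shear (snd x) * snd k, snd k))) (at x)"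
proof -
  define g where "g y = (fst y + rotation (snd y)) / perimeter R" for y
  define n where "n = \<lfloor>g x\<rfloor>"
  have s: "\<bar>snd x\<bar> < 1" and gx: "g x \<notin> \<int>" using assms by (auto simp: regular_def g_def)
  have rot: "((\<lambda>y. rotation (snd y)) has_derivative (\<lambda>k. snd k * shear (snd x))) (at x)"
    by (rule has_derivative_compose[OF has_derivative_snd[OF has_derivative_ident], unfolded o_def])
       (use rotation_has_derivative[OF s] in \<open>simp add: has_field_derivative_def mult_commute_abs\<close>)
  have "isCont (\<lambda>y. rotation (snd y)) x"
    using has_derivative_continuous[OF rot] by simp
  then have cont: "isCont g x"
    unfolding g_def using perimeter_pos by (intro continuous_intros) auto
  have "of_int n \<noteq> g x" using gx by (metis Ints_of_int)
  then have n: "of_int n < g x" "g x < of_int n + 1"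
    unfolding n_def by linarith+
  have "((\<lambda>y. \<bar>snd y\<bar>) \<longlongrightarrow> \<bar>snd x\<bar>) (at x)" by (intro tendsto_intros)
  then have "\<forall>\<^sub>F y in at x. \<bar>snd y\<bar> < 1" using s by (rule order_tendstoD)
  moreover have "\<forall>\<^sub>F y in at x. of_int n < g y" "\<forall>\<^sub>F y in at x. g y < of_int n + 1"
    using cont n by (auto simp: isCont_def dest: order_tendstoD)
  ultimately have ev: "\<forall>\<^sub>F y in at x. (fst y + rotation (snd y) - perimeter R * of_int n, snd y) = billiard_map R y"
  proof eventually_elim
    case (elim y)
    then have "\<lfloor>g y\<rfloor> = n" by linarith
    then have "perimeter R * frac (g y) = fst y + rotation (snd y) - perimeter R * of_int n"
      using perimeter_pos by (simp add: frac_def g_def right_diff_distrib)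
    with elim show ?case by (simp add: billiard_map_eq chord_map_def g_def)
  qed
  have "perimeter R * frac (g x) = fst x + rotation (snd x) - perimeter R * of_int n"
    using perimeter_pos by (simp add: frac_def g_def n_def right_diff_distrib)
  then have at: "(fst x + rotation (snd x) - perimeter R * of_int n, snd x) = billiard_map R x"
    using s by (simp add: billiard_map_eq chord_map_def g_def)
  have "((\<lambda>y. (fst y + rotation (snd y) - perimeter R * of_int n, snd y)) has_derivative
    (\<lambda>k. (fst k + snd k * shear (snd x) - 0, snd k))) (at x)"
    by (intro has_derivative_Pair has_derivative_diff has_derivative_add has_derivative_fst has_derivative_snd
        has_derivative_ident has_derivative_const rot)
  from has_derivative_transform_eventually[OF this ev at]
  show ?thesis by (simp add: mult.commute)
qed

text \<open>Approached from smaller \<open>r\<close>, the image tends to the far end of the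
  fundamental domain, whereas the value at the point is 0. Failure of differentiability is what
  makes the Jacobian take its default value here.\<close>

lemma not_differentiable_seam:
  assumes s: "\<bar>s\<bar> < 1" and seam: "(r + rotation s) / perimeter R \<in> \<int>"
  shows "\<not> billiard_map R differentiable (at (r, s))"
proof
  assume "billiard_map R differentiable (at (r, s))"
  then have "isCont (billiard_map R) (r, s)" by (rule differentiable_imp_continuous_within)
  moreover have "((\<lambda>h. (r - h, s)) \<longlongrightarrow> (r - 0, s)) (at_right 0)" by (intro tendsto_intros)
  ultimately have "((\<lambda>h. fst (billiard_map R (r - h, s))) \<longlongrightarrow> fst (billiard_map R (r, s))) (at_right 0)"
    by (intro tendsto_fst isCont_tendsto_compose[of "(r, s)" "billiard_map R"]) simp_all
  moreover have "fst (billiard_map R (r, s)) = 0"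
    using s seam by (simp add: billiard_map_eq chord_map_def)
  moreover have "\<forall>\<^sub>F h in at_right 0. fst (billiard_map R (r - h, s)) = perimeter R - h"
    using eventually_at_right_real[OF perimeter_pos]
  proof eventually_elim
    case (elim h)
    obtain n :: int where n: "(r + rotation s) / perimeter R = of_int n" using seam by (auto elim: Ints_cases)
    \<comment> \<open>Below the integer \<open>n\<close> the integer part drops to
      \<open>n - 1\<close>; for small \<open>h\<close> the fractional part is therefore close to
      1.\<close>
    have "(r - h + rotation s) / perimeter R = (1 - h / perimeter R) + of_int (n - 1)"
      using n perimeter_pos by (simp add: field_simps)
    then have "frac ((r - h + rotation s) / perimeter R) = frac (1 - h / perimeter R)"
      by (simp only: frac_add_of_int)
    also have "\<dots> = 1 - h / perimeter R"
      using elim perimeter_pos by (intro frac_eq[THEN iffD2]) (auto simp: field_simps)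
    finally show ?case
      using s perimeter_pos by (simp add: billiard_map_eq chord_map_def right_diff_distrib)
  qed
  ultimately have "((\<lambda>h. perimeter R - h) \<longlongrightarrow> 0) (at_right 0)"
    by (simp add: tendsto_cong)
  moreover have "((\<lambda>h. perimeter R - h) \<longlongrightarrow> perimeter R - 0) (at_right 0)" by (intro tendsto_intros)
  ultimately show False
    using tendsto_unique[OF trivial_limit_at_right_real] perimeter_pos by fastforce
qed

text \<open>The path \<open>(r, \<sigma> cos h)\<close> reaches the tangential collision \<open>(r, \<sigma>)\<close> with zero speed, but the
  billiard map moves its image with speed \<open>2 R\<close>.\<close>

lemma tangential_quotient:
  assumes \<sigma>: "\<bar>\<sigma>\<bar> = 1" and diff: "billiard_map R differentiable (at (r, \<sigma>))"
  shows "((\<lambda>h. (fst (billiard_map R (r, \<sigma> * cos h)) - r) / h) \<longlongrightarrow> 0) (at_right 0)"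
proof -
  obtain D where D: "(billiard_map R has_derivative D) (at (r, \<sigma>))"
    using diff by (auto simp: differentiable_def)
  have "((\<lambda>h. (r, \<sigma> * cos h)) has_derivative (\<lambda>k. (0, 0))) (at 0)"
    by (auto intro!: derivative_eq_intros)
  from has_derivative_compose[OF this, of "billiard_map R" D] D
  have "((\<lambda>h. billiard_map R (r, \<sigma> * cos h)) has_derivative (\<lambda>k. D (0, 0))) (at 0)" by simp
  moreover have "D (0, 0) = 0"
    using linear_0[OF has_derivative_linear[OF D]] by (simp add: zero_prod_def)
  ultimately have "((\<lambda>h. fst (billiard_map R (r, \<sigma> * cos h))) has_derivative (\<lambda>k. 0)) (at 0)"
    using has_derivative_fst by fastforce
  then have "((\<lambda>h. fst (billiard_map R (r, \<sigma> * cos h))) has_real_derivative 0) (at 0)"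
    by (simp add: has_field_derivative_def lambda_zero[symmetric])
  then have "((\<lambda>h. fst (billiard_map R (r, \<sigma> * cos h))) has_real_derivative 0) (at 0 within {0<..})"
    by (rule has_field_derivative_at_within)
  \<comment> \<open>The tangential collision is fixed by convention, so the difference quotient is
    taken relative to \<open>r\<close>.\<close>
  then show ?thesis
    using \<sigma> by (simp add: has_field_derivative_iff billiard_map_eq)
qed

lemma arcsin_cos: "0 < h \<Longrightarrow> h < pi \<Longrightarrow> arcsin (cos h) = pi / 2 - h"
  using arcsin_sin[of "pi / 2 - h"] by (simp add: cos_sin_eq)

text \<open>Near \<sigma> = 1 the image creeps forward by \<open>2 * R * h\<close>; near \<sigma> =
  -1 it goes almost once around, hence backward by the same amount. Either way the quotient stays at
  distance \<open>2 * R\<close> from 0. If also \<open>r = 0\<close>, the backward motion crosses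
  the seam and continuity itself fails.\<close>

lemma not_differentiable_tangential:
  assumes r: "0 \<le> r" "r < perimeter R" and \<sigma>: "\<bar>\<sigma>\<bar> = 1"
  shows "\<not> billiard_map R differentiable (at (r, \<sigma>))"
proof
  assume "billiard_map R differentiable (at (r, \<sigma>))"
  note lim = tangential_quotient[OF \<sigma> this]
  have cos_lt: "\<bar>cos h\<bar> < 1" if "0 < h" "h < pi" for h :: real
    using that cos_monotone_0_pi[of 0 h] cos_monotone_0_pi[of h pi] by auto
  consider "\<sigma> = 1" | "\<sigma> = -1" "0 < r" | "\<sigma> = -1" "r = 0" using \<sigma> r(1) by linarith
  then show False
  proof cases
    case 1
    \<comment> \<open>The first bound puts \<open>h\<close> in the range of
      \<open>arcsin_cos\<close>, the second keeps the image from wrapping around.\<close>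
    have pos: "0 < min pi ((perimeter R - r) / (2 * R))" using r R_pos by simp
    have "\<forall>\<^sub>F h in at_right 0. (fst (billiard_map R (r, \<sigma> * cos h)) - r) / h = 2 * R"
      using eventually_at_right_real[OF pos]
    proof eventually_elim
      case (elim h)
      then have h: "0 < h" "h < pi" "r + 2 * R * h < perimeter R" using R_pos by (auto simp: field_simps)
      have "frac ((r + 2 * R * h) / perimeter R) = (r + 2 * R * h) / perimeter R"
        using h r R_pos perimeter_pos by (intro frac_eq[THEN iffD2]) auto
      moreover have "rotation (cos h) = 2 * R * h" using h by (simp add: rotation_def arcsin_cos)
      ultimately show ?case
        using h 1 cos_lt[OF h(1,2)] perimeter_pos by (simp add: billiard_map_eq chord_map_def)
    qed
    with lim have "((\<lambda>h::real. 2 * R) \<longlongrightarrow> 0) (at_right 0)" by (simp add: tendsto_cong)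
    then show False using R_pos by (simp add: tendsto_const_iff)
  next
    case 2
    have pos: "0 < min pi (r / (2 * R))" using 2 R_pos by simp
    have "\<forall>\<^sub>F h in at_right 0. (fst (billiard_map R (r, \<sigma> * cos h)) - r) / h = - 2 * R"
      using eventually_at_right_real[OF pos]
    proof eventually_elim
      case (elim h)
      then have h: "0 < h" "h < pi" "2 * R * h < r" using R_pos by (auto simp: field_simps)
      have rot: "rotation (- cos h) = perimeter R - 2 * R * h"
        using h cos_lt[OF h(1,2)] by (simp add: rotation_def arcsin_minus abs_le_iff less_imp_le arcsin_cos perimeter_def algebra_simps)
      have "(r + rotation (- cos h)) / perimeter R = (r - 2 * R * h) / perimeter R + of_int 1"
        unfolding rot using perimeter_pos by (simp add: field_simps)
      then have "frac ((r + rotation (- cos h)) / perimeter R) = frac ((r - 2 * R * h) / perimeter R)"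
        by (simp only: frac_add_of_int)
      also have "\<dots> = (r - 2 * R * h) / perimeter R"
      proof -
        have "0 \<le> r - 2 * R * h" "r - 2 * R * h < perimeter R"
          using h r mult_pos_pos[OF R_pos h(1)] by linarith+
        then show ?thesis using perimeter_pos by (simp add: frac_eq)
      qed
      finally show ?case
        using h 2 cos_lt[OF h(1,2)] perimeter_pos by (simp add: billiard_map_eq chord_map_def)
    qed
    with lim have "((\<lambda>h::real. - 2 * R) \<longlongrightarrow> 0) (at_right 0)" by (simp add: tendsto_cong)
    then show False using R_pos by (simp add: tendsto_const_iff)
  next
    case 3
    have pos: "0 < pi" by simp
    \<comment> \<open>Multiplying the quotient by \<open>h\<close> leaves the increment itself,
      which would have to tend to 0 but tends to the perimeter.\<close>
    have "((\<lambda>h. (fst (billiard_map R (r, \<sigma> * cos h)) - r) / h * h) \<longlongrightarrow> 0 * 0) (at_right 0)"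
      by (intro tendsto_mult lim tendsto_ident_at)
    moreover have "\<forall>\<^sub>F h in at_right 0. (fst (billiard_map R (r, \<sigma> * cos h)) - r) / h * h = perimeter R - 2 * R * h"
      using eventually_at_right_real[OF pos]
    proof eventually_elim
      case (elim h)
      then have h: "0 < h" "h < pi" by auto
      have rot: "rotation (- cos h) = perimeter R - 2 * R * h"
        using h cos_lt[OF h] by (simp add: rotation_def arcsin_minus abs_le_iff less_imp_le arcsin_cos perimeter_def algebra_simps)
      have "2 * R * h < perimeter R" "0 < R * h" using h R_pos by (simp_all add: perimeter_def)
      then have "frac ((perimeter R - 2 * R * h) / perimeter R) = (perimeter R - 2 * R * h) / perimeter R"
        using perimeter_pos by (intro frac_eq[THEN iffD2]) auto
      then show ?case
        using h 3 cos_lt[OF h] perimeter_pos by (simp add: billiard_map_eq chord_map_def rot)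
    qed
    ultimately have "((\<lambda>h. perimeter R - 2 * R * h) \<longlongrightarrow> 0) (at_right 0)" by (simp add: tendsto_cong)
    moreover have "((\<lambda>h. perimeter R - 2 * R * h) \<longlongrightarrow> perimeter R - 2 * R * 0) (at_right 0)" by (intro tendsto_intros)
    ultimately show False
      using tendsto_unique[OF trivial_limit_at_right_real] perimeter_pos by fastforce
  qed
qed

text \<open>The value 0 at non-regular points encodes the default Jacobian, as
  \<open>transvection 0\<close> is the identity.\<close>

definition shear_at :: "real \<times> real \<Rightarrow> real" where
  "shear_at x = (if regular x then shear (snd x) else 0)"

lemma jacobian_billiard_map:
  assumes "x \<in> collision_space R"
  shows "jacobian_matrix (billiard_map R) x = transvection (shear_at x)"
proof (cases "regular x")
  case True
  from billiard_map_has_derivative[OF True]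
  have "billiard_map R differentiable (at x)"
    and "frechet_derivative (billiard_map R) (at x) = (\<lambda>k. (fst k + shear (snd x) * snd k, snd k))"
    by (auto simp: differentiable_def frechet_derivative_at[symmetric])
  then show ?thesis
    using True by (simp add: jacobian_matrix_def transvection_def shear_at_def)
next
  case False
  obtain r s where x: "x = (r, s)" by (cases x)
  have "\<not> billiard_map R differentiable (at x)"
  proof (cases "\<bar>s\<bar> < 1")
    case True
    with False show ?thesis unfolding x by (intro not_differentiable_seam) (auto simp: regular_def x)
  next
    case False
    with assms show ?thesis unfolding x by (intro not_differentiable_tangential) (auto simp: collision_space_def x)
  qed
  then show ?thesis
    using False by (simp add: jacobian_matrix_def shear_at_def transvection_0)
qed

end

section \<open>Stationarity and irreducibility of the random billiard\<close>

lemma borel_measurable_fst[measurable]: "fst \<in> borel_measurable (borel :: (real \<times> real) measure)"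
  and borel_measurable_snd[measurable]: "snd \<in> borel_measurable (borel :: (real \<times> real) measure)"
  by (intro borel_measurable_continuous_onI continuous_intros)+

text \<open>Outside \<open>[-1, 1]\<close> the description defining \<open>arcsin\<close> is
  unsatisfiable, so all values there equal one fixed default and measurability reduces to continuity
  on the interval.\<close>

lemma borel_measurable_arcsin[measurable]: "arcsin \<in> borel_measurable borel"
proof -
  have "arcsin = (\<lambda>x. if x \<in> {-1..1} then arcsin x else (THE y. False))"
  proof
    fix x :: real
    have "(THE y. - (pi / 2) \<le> y \<and> y \<le> pi / 2 \<and> sin y = x) = (THE y. False)" if "x \<notin> {-1..1}"
      using that by (intro arg_cong[where f=The]) auto
    then show "arcsin x = (if x \<in> {-1..1} then arcsin x else (THE y. False))"
      by (auto simp: arcsin_def)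
  qed
  also have "\<dots> \<in> borel_measurable borel"
    by (rule borel_measurable_continuous_on_if) (auto intro!: continuous_intros)
  finally show ?thesis .
qed

text \<open>On each horizontal line a shear is a translation. Fubini with the
  \<open>s\<close>-integral outside leaves translation invariance on the line, used once in each
  coordinate.\<close>

lemma nn_integral_shear:
  fixes f :: "real \<times> real \<Rightarrow> ennreal"
  assumes f[measurable]: "f \<in> borel_measurable borel" and a[measurable]: "a \<in> borel_measurable borel"
  shows "(\<integral>\<^sup>+x. f (fst x + a (snd x), snd x + d) \<partial>lborel) = (\<integral>\<^sup>+x. f x \<partial>lborel)"
proof -
  have translate: "(\<integral>\<^sup>+r. g (r + t) \<partial>lborel) = (\<integral>\<^sup>+r. g r \<partial>lborel)"
    if "g \<in> borel_measurable borel" for g :: "real \<Rightarrow> ennreal" and t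
    using nn_integral_real_affine[OF that, of 1 t] by (simp add: add.commute)
  have f': "f \<in> borel_measurable (lborel \<Otimes>\<^sub>M lborel)"
    by (simp add: lborel_prod)
  have fT: "(\<lambda>x. f (fst x + a (snd x), snd x + d)) \<in> borel_measurable (lborel \<Otimes>\<^sub>M lborel)"
    by measurable
  have "(\<integral>\<^sup>+x. f (fst x + a (snd x), snd x + d) \<partial>lborel) =
    (\<integral>\<^sup>+s. \<integral>\<^sup>+r. f (r + a s, s + d) \<partial>lborel \<partial>lborel)"
    unfolding lborel_prod[symmetric] by (subst lborel_pair.nn_integral_snd[OF fT, symmetric]) simp
  also have "\<dots> = (\<integral>\<^sup>+s. \<integral>\<^sup>+r. f (r, s + d) \<partial>lborel \<partial>lborel)"
    by (intro nn_integral_cong translate) simp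
  also have "\<dots> = (\<integral>\<^sup>+s. \<integral>\<^sup>+r. f (r, s) \<partial>lborel \<partial>lborel)"
    by (rule translate[where g="\<lambda>s. \<integral>\<^sup>+r. f (r, s) \<partial>lborel"]) simp
  also have "\<dots> = (\<integral>\<^sup>+x. f x \<partial>lborel)"
    unfolding lborel_prod[symmetric] by (rule lborel_pair.nn_integral_snd[OF f'])
  finally show ?thesis .
qed

lemma AE_fst_neq: "AE x in (lborel :: (real \<times> real) measure). fst x \<noteq> c"
proof (rule AE_I')
  show "{c} \<times> UNIV \<in> null_sets (lborel :: (real \<times> real) measure)"
    unfolding lborel_prod[symmetric] by (intro null_setsI) (simp_all add: lborel.emeasure_pair_measure_Times)
qed auto

lemma AE_snd_neq: "AE x in (lborel :: (real \<times> real) measure). snd x \<noteq> c"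
proof (rule AE_I')
  show "UNIV \<times> {c} \<in> null_sets (lborel :: (real \<times> real) measure)"
    unfolding lborel_prod[symmetric] by (intro null_setsI) (simp_all add: lborel.emeasure_pair_measure_Times)
qed auto

lemma open_not_AE_empty:
  fixes S :: "'a::euclidean_space set"
  assumes "open S" "S \<noteq> {}"
  shows "\<not> (AE x in lborel. x \<notin> S)"
proof
  assume "AE x in lborel. x \<notin> S"
  then have "S \<in> null_sets lborel" using assms by (subst AE_iff_null_sets) auto
  then have "negligible S" using assms by (simp add: negligible_iff_null_sets null_sets_completion_iff)
  then show False using assms open_not_negligible by blast
qed

text \<open>The constant may depend on the ball a priori; overlapping balls force the constants to agree.\<close>

lemma connected_AE_locally_const:
  fixes h :: "'a::euclidean_space \<Rightarrow> 'b"
  assumes U: "open U" "connected U" and \<delta>: "\<delta> > 0"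
    and N: "\<And>c. {y \<in> U. h y \<noteq> c} \<in> sets borel"
    and loc: "\<And>z. z \<in> U \<Longrightarrow> \<exists>c. AE y in lborel. y \<in> ball z \<delta> \<inter> U \<longrightarrow> h y = c"
  shows "\<exists>c. AE y in lborel. y \<in> U \<longrightarrow> h y = c"
proof (cases "U = {}")
  case False
  then obtain z0 where z0: "z0 \<in> U" by blast
  define c where "c z = (SOME c. AE y in lborel. y \<in> ball z \<delta> \<inter> U \<longrightarrow> h y = c)" for z
  have c: "AE y in lborel. y \<in> ball z \<delta> \<inter> U \<longrightarrow> h y = c z" if "z \<in> U" for z
    unfolding c_def by (rule someI_ex[OF loc[OF that]])
  have "\<forall>\<^sub>F z' in at z within U. c z = c z'" if z: "z \<in> U" for z
  proof -
    have "c z = c z'" if z': "z' \<in> U" "dist z' z < \<delta>" for z'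
    proof (rule ccontr)
      assume neq: "c z \<noteq> c z'"
      have "AE y in lborel. y \<notin> ball z \<delta> \<inter> ball z' \<delta> \<inter> U"
        using c[OF z] c[OF z'(1)] by eventually_elim (use neq in auto)
      moreover have "z' \<in> ball z \<delta> \<inter> ball z' \<delta> \<inter> U" using z' \<delta> by (simp add: dist_commute)
      ultimately show False
        using open_not_AE_empty[of "ball z \<delta> \<inter> ball z' \<delta> \<inter> U"] U(1) by blast
    qed
    then show ?thesis unfolding eventually_at using \<delta> by blast
  qed
  then have const: "c z = c z0" if "z \<in> U" for z
    using connected_local_const[OF U(2) that z0, of c] by blast
  define B where "B = {y \<in> U. h y \<noteq> c z0}"
  have B: "B \<in> sets borel" unfolding B_def by (rule N)
  \<comment> \<open>A locally null set is null, which passes from single balls to all of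
    \<open>U\<close>.\<close>
  have "negligible B"
  proof (rule locally_negligible_alt[THEN iffD2], rule ballI)
    fix z assume z: "z \<in> B"
    then have zU: "z \<in> U" by (simp add: B_def)
    have "AE y in lborel. y \<notin> B \<inter> ball z \<delta>"
      using c[OF zU] by eventually_elim (use const[OF zU] in \<open>auto simp: B_def\<close>)
    then have "B \<inter> ball z \<delta> \<in> null_sets lborel"
      using B by (subst AE_iff_null_sets) auto
    then have "negligible (B \<inter> ball z \<delta>)"
      unfolding negligible_iff_null_sets by (rule null_sets_completionI)
    moreover have "openin (top_of_set B) (B \<inter> ball z \<delta>)" by (rule openin_open_Int) simp
    ultimately show "\<exists>V. openin (top_of_set B) V \<and> z \<in> V \<and> negligible V"
      using z \<delta> by (intro exI[of _ "B \<inter> ball z \<delta>"]) simp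
  qed
  then have "B \<in> null_sets lborel"
    unfolding negligible_iff_null_sets using B by (simp add: null_sets_completion_iff)
  then have "AE y in lborel. y \<notin> B" by (rule AE_not_in)
  then show ?thesis
    by (intro exI[of _ "c z0"]) (auto simp: B_def elim: eventually_mono)
qed simp

context circular_billiard
begin

section \<open>The collision measure and the period lattice\<close>

abbreviation "L \<equiv> perimeter R"
abbreviation "M \<equiv> collision_space R"
abbreviation "m \<equiv> collision_measure R"

lemma rotation_measurable[measurable]: "rotation \<in> borel_measurable borel"
  unfolding rotation_def[abs_def] by measurable

lemma collision_space_borel[measurable]: "M \<in> sets borel"
  unfolding collision_space_def by (intro borel_Times) auto

lemma space_collision_measure: "space m = M"
  by (simp add: collision_measure_def space_restrict_space)

lemma sets_collision_borel: "sets (collision_borel R) = sets m"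
  by (simp add: collision_measure_def collision_borel_def sets_restrict_space)

lemma sets_collision_measure_iff: "B \<in> sets m \<longleftrightarrow> B \<in> sets borel \<and> B \<subseteq> M"
  by (auto simp: collision_measure_def sets_restrict_space_iff)

lemma measurable_collision_measure:
  assumes f: "f \<in> borel \<rightarrow>\<^sub>M N"
  shows "f \<in> m \<rightarrow>\<^sub>M N"
proof -
  have "sets m = sets (restrict_space borel M)"
    by (simp add: collision_measure_def sets_restrict_space)
  then have "m \<rightarrow>\<^sub>M N = restrict_space borel M \<rightarrow>\<^sub>M N"
    by (rule measurable_cong_sets) simp
  then show ?thesis using measurable_restrict_space1[OF f, of M] by simp
qed

lemma nn_integral_collision_measure:
  assumes f: "f \<in> borel_measurable m"
  shows "(\<integral>\<^sup>+x. f x \<partial>m) = ennreal (1 / (2 * L)) * (\<integral>\<^sup>+x. f x * indicator M x \<partial>lborel)"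
proof -
  have f': "f \<in> borel_measurable (restrict_space lborel M)"
    using f by (simp add: collision_measure_def)
  have "(\<integral>\<^sup>+x. f x \<partial>m) = (\<integral>\<^sup>+x. ennreal (1 / (2 * L)) * f x \<partial>restrict_space lborel M)"
    unfolding collision_measure_def using f' by (subst nn_integral_density) simp_all
  also have "\<dots> = ennreal (1 / (2 * L)) * (\<integral>\<^sup>+x. f x \<partial>restrict_space lborel M)"
    using f' by (rule nn_integral_cmult)
  also have "(\<integral>\<^sup>+x. f x \<partial>restrict_space lborel M) = (\<integral>\<^sup>+x. f x * indicator M x \<partial>lborel)"
    by (rule nn_integral_restrict_space) simp
  finally show ?thesis .
qed

lemma emeasure_collision_measure:
  assumes "B \<in> sets m"
  shows "emeasure m B = ennreal (1 / (2 * L)) * emeasure lborel B"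
proof -
  have B: "B \<in> sets borel" "B \<subseteq> M" using assms by (auto simp: sets_collision_measure_iff)
  have "emeasure m B = (\<integral>\<^sup>+x. indicator B x \<partial>m)" using assms by simp
  also have "\<dots> = ennreal (1 / (2 * L)) * (\<integral>\<^sup>+x. indicator B x * indicator M x \<partial>lborel)"
    using assms by (intro nn_integral_collision_measure) simp
  also have "(\<integral>\<^sup>+x. indicator B x * indicator M x \<partial>lborel) = (\<integral>\<^sup>+x. indicator B x \<partial>lborel)"
    using B by (intro nn_integral_cong) (auto split: split_indicator)
  finally show ?thesis using B by simp
qed

lemma emeasure_collision_space: "emeasure lborel M = ennreal (2 * L)"
proof -
  have "emeasure lborel M = ennreal L * ennreal 2"
    unfolding collision_space_def lborel_prod[symmetric]
    using perimeter_pos by (subst lborel.emeasure_pair_measure_Times) auto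
  then show ?thesis
    using perimeter_pos ennreal_mult[of L 2] by (simp add: mult.commute)
qed

lemma prob_space_collision_measure: "prob_space m"
proof
  show "emeasure m (space m) = 1"
    using perimeter_pos
    by (simp add: space_collision_measure emeasure_collision_measure sets_collision_measure_iff
        emeasure_collision_space ennreal_mult''[symmetric])
qed

lemma AE_collision_measure: "(AE x in m. Q x) \<longleftrightarrow> (AE x in lborel. x \<in> M \<longrightarrow> Q x)"
  unfolding collision_measure_def using perimeter_pos
  by (subst AE_density) (simp_all add: AE_restrict_space_iff)

lemma countable_period_lattice: "countable (period_lattice R)"
proof -
  have "period_lattice R = range (\<lambda>(a, b). (L * of_int a, 2 * of_int b))"
    by (auto simp: period_lattice_def)
  then show ?thesis by simp
qed

text \<open>The half-open cell \<open>[0, L) \<times> [-1, 1)\<close> meets every orbit of the lattice at most once, so sheared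
  translations act injectively on it.\<close>

lemma emeasure_shear_mod_lattice_le:
  assumes B[measurable]: "B \<in> sets borel" and a[measurable]: "a \<in> borel_measurable borel"
  shows "emeasure lborel {x \<in> M. \<exists>w\<in>period_lattice R. (fst x + a (snd x), snd x + d) - w \<in> B} \<le> emeasure lborel B"
proof -
  define C where "C = {0..<L} \<times> {-1..<1::real}"
  have [measurable]: "C \<in> sets borel" unfolding C_def by (intro borel_Times) auto
  \<comment> \<open>\<open>T k\<close> is the sheared translation with the lattice vector of index
    \<open>k\<close> subtracted, and \<open>S k\<close> inverts it. Pulling the cell
    \<open>C\<close> back through \<open>S k\<close> allows counting by image point.\<close>
  define T where "T = (\<lambda>(i::int, j::int) x. (fst x + (a (snd x) - L * of_int i), snd x + (d - 2 * of_int j)))"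
  define S where "S = (\<lambda>(i::int, j::int) y. (fst y + L * of_int i - a (snd y + 2 * of_int j - d), snd y + 2 * of_int j - d))"
  have ST: "S k (T k x) = x" for k x by (cases k) (simp add: S_def T_def)
  have S_meas[measurable]: "S k \<in> borel_measurable borel" for k
    unfolding S_def by (cases k) (simp add: borel_prod[symmetric])
  have T_meas[measurable]: "T k \<in> borel_measurable borel" for k
    unfolding T_def by (cases k) (simp add: borel_prod[symmetric])
  have "emeasure lborel {x \<in> M. \<exists>w\<in>period_lattice R. (fst x + a (snd x), snd x + d) - w \<in> B} =
      emeasure lborel {x \<in> M. \<exists>k. T k x \<in> B}"
    by (rule arg_cong[where f="emeasure lborel"]) (force simp: period_lattice_def T_def algebra_simps)
  also have "\<dots> = (\<integral>\<^sup>+x. indicator {x \<in> M. \<exists>k. T k x \<in> B} x \<partial>lborel)"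
    by (rule nn_integral_indicator[symmetric]) measurable
  \<comment> \<open>The line \<open>s = 1\<close> is congruent to \<open>s = -1\<close> modulo the
    lattice and must be dropped; it is a null set. The existential over lattice vectors is bounded
    by a sum.\<close>
  also have "\<dots> \<le> (\<integral>\<^sup>+x. \<integral>\<^sup>+k. indicator C x * indicator B (T k x) \<partial>count_space UNIV \<partial>lborel)"
  proof (rule nn_integral_mono_AE)
    show "AE x in lborel. indicator {x \<in> M. \<exists>k. T k x \<in> B} x \<le>
        (\<integral>\<^sup>+k. indicator C x * indicator B (T k x) \<partial>count_space UNIV)"
      using AE_snd_neq[of 1]
    proof eventually_elim
      case (elim x)
      show ?case
      proof (cases "x \<in> {x \<in> M. \<exists>k. T k x \<in> B}")
        case True
        then obtain k where k: "T k x \<in> B" and xM: "x \<in> M" by blast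
        have "x \<in> C" using xM elim by (auto simp: C_def collision_space_def)
        have "1 = (\<integral>\<^sup>+k'. indicator {k} k' \<partial>count_space UNIV :: ennreal)"
          by (subst nn_integral_indicator) simp_all
        also have "\<dots> \<le> (\<integral>\<^sup>+k. indicator C x * indicator B (T k x) \<partial>count_space UNIV)"
          using k \<open>x \<in> C\<close> by (intro nn_integral_mono) (auto split: split_indicator)
        finally show ?thesis using True by simp
      qed simp
    qed
  qed
  also have "\<dots> = (\<integral>\<^sup>+k. \<integral>\<^sup>+x. indicator C x * indicator B (T k x) \<partial>lborel \<partial>count_space UNIV)"
    by (rule nn_integral_count_space_nn_integral) auto
  also have "\<dots> = (\<integral>\<^sup>+k. \<integral>\<^sup>+y. indicator C (S k y) * indicator B y \<partial>lborel \<partial>count_space UNIV)"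
  proof (rule nn_integral_cong)
    fix k :: "int \<times> int"
    obtain i j where k: "k = (i, j)" by (cases k)
    define f :: "real \<times> real \<Rightarrow> ennreal" where "f y = indicator C (S k y) * indicator B y" for y
    have "f (T k x) = indicator C x * indicator B (T k x)" for x by (simp add: f_def ST)
    then have "(\<integral>\<^sup>+x. indicator C x * indicator B (T k x) \<partial>lborel) =
      (\<integral>\<^sup>+x. f (fst x + (a (snd x) - L * of_int i), snd x + (d - 2 * of_int j)) \<partial>lborel)"
      by (simp add: T_def k)
    also have "\<dots> = (\<integral>\<^sup>+x. f x \<partial>lborel)"
      by (rule nn_integral_shear) (simp_all add: f_def)
    finally show "(\<integral>\<^sup>+x. indicator C x * indicator B (T k x) \<partial>lborel) = (\<integral>\<^sup>+y. indicator C (S k y) * indicator B y \<partial>lborel)"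
      by (simp add: f_def)
  qed
  \<comment> \<open>With the sum inside, the image point \<open>y\<close> is fixed, and at most one
    index \<open>k\<close> can bring it back into the cell.\<close>
  also have "\<dots> = (\<integral>\<^sup>+y. \<integral>\<^sup>+k. indicator C (S k y) * indicator B y \<partial>count_space UNIV \<partial>lborel)"
    by (rule nn_integral_count_space_nn_integral[symmetric]) auto
  also have "\<dots> \<le> (\<integral>\<^sup>+y. indicator B y \<partial>lborel)"
  proof (rule nn_integral_mono)
    fix y :: "real \<times> real"
    have unique: "k = k'" if kk: "S k y \<in> C" "S k' y \<in> C" for k k'
    proof -
      obtain i j i' j' where k: "k = (i, j)" and k': "k' = (i', j')" by (cases k, cases k')
      \<comment> \<open>The second coordinate comes first: only once \<open>j = j'\<close> do the
        two shear terms coincide and cancel in the first coordinate.\<close>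
      have "\<bar>2 * (of_int j - of_int j' :: real)\<bar> < 2"
        using kk by (auto simp: S_def C_def k k')
      then have "\<bar>of_int (j - j') :: real\<bar> < 1" by simp
      then have j: "j = j'" by linarith
      have "\<bar>L * (of_int i - of_int i')\<bar> < L"
        using kk by (auto simp: S_def C_def k k' j algebra_simps)
      then have "L * \<bar>of_int i - of_int i'\<bar> < L * 1"
        using perimeter_pos by (simp add: abs_mult)
      then have "\<bar>of_int (i - i') :: real\<bar> < 1" using perimeter_pos by (metis mult_less_cancel_left_pos of_int_diff)
      then have "i = i'" by linarith
      with j show ?thesis by (simp add: k k')
    qed
    have "(\<integral>\<^sup>+k. indicator C (S k y) \<partial>count_space UNIV) \<le> (1::ennreal)"
    proof (cases "\<exists>k. S k y \<in> C")
      case True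
      then obtain k0 where k0: "S k0 y \<in> C" by blast
      have "(\<integral>\<^sup>+k. indicator C (S k y) \<partial>count_space UNIV) \<le> (\<integral>\<^sup>+k. indicator {k0} k \<partial>count_space UNIV :: ennreal)"
      proof (rule nn_integral_mono)
        show "indicator C (S k y) \<le> (indicator {k0} k :: ennreal)" for k
          using unique[of k k0] k0 by (cases "S k y \<in> C") simp_all
      qed
      also have "\<dots> = 1" by (subst nn_integral_indicator) simp_all
      finally show ?thesis .
    next
      case False
      then have "indicator C (S k y) = (0::ennreal)" for k by (metis indicator_simps(2))
      then show ?thesis by simp
    qed
    then show "(\<integral>\<^sup>+k. indicator C (S k y) * indicator B y \<partial>count_space UNIV) \<le> indicator B y"
      by (auto split: split_indicator)
  qed
  finally show ?thesis using B by simp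
qed

section \<open>Invariance of the collision measure\<close>

lemma billiard_map_mod_lattice:
  assumes "\<bar>snd x\<bar> < 1"
  obtains w where "w \<in> period_lattice R" "billiard_map R x = (fst x + rotation (snd x), snd x) - w"
proof
  let ?w = "(L * of_int \<lfloor>(fst x + rotation (snd x)) / L\<rfloor>, 2 * of_int 0)"
  show "?w \<in> period_lattice R" unfolding period_lattice_def by blast
  show "billiard_map R x = (fst x + rotation (snd x), snd x) - ?w"
    using assms perimeter_pos by (simp add: billiard_map_eq chord_map_def frac_def right_diff_distrib)
qed

lemma billiard_map_in_collision_space: "x \<in> M \<Longrightarrow> billiard_map R x \<in> M"
  using chord_map_in_collision_space[of x] by (auto simp: billiard_map_eq)

lemma period_lattice_add: "v \<in> period_lattice R \<Longrightarrow> w \<in> period_lattice R \<Longrightarrow> v + w \<in> period_lattice R"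
proof -
  assume "v \<in> period_lattice R" "w \<in> period_lattice R"
  then obtain i j i' j' where "v = (L * of_int i, 2 * of_int j)" "w = (L * of_int i', 2 * of_int j')"
    by (auto simp: period_lattice_def)
  then have "v + w = (L * of_int (i + i'), 2 * of_int (j + j'))" by (simp add: algebra_simps)
  then show ?thesis unfolding period_lattice_def by blast
qed

lemma period_lattice_uminus: "v \<in> period_lattice R \<Longrightarrow> - v \<in> period_lattice R"
proof -
  assume "v \<in> period_lattice R"
  then obtain i j where "v = (L * of_int i, 2 * of_int j)" by (auto simp: period_lattice_def)
  then have "- v = (L * of_int (- i), 2 * of_int (- j))" by simp
  then show ?thesis unfolding period_lattice_def by blast
qed

text \<open>The quantifier over the lattice absorbs the reduction modulo the perimeter, so the
  billiard map may be replaced by its lift, the plain shear.\<close>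

lemma perturbation_billiard_map:
  assumes "\<bar>snd x\<bar> < 1"
  shows "perturbation R \<nu> (billiard_map R x) B =
    emeasure \<nu> {u. \<exists>w\<in>period_lattice R. u + (fst x + rotation (snd x), snd x) - w \<in> B}"
proof -
  obtain v where v: "v \<in> period_lattice R" "billiard_map R x = (fst x + rotation (snd x), snd x) - v"
    using billiard_map_mod_lattice[OF assms] .
  have "(\<exists>w\<in>period_lattice R. u + billiard_map R x - w \<in> B) \<longleftrightarrow>
    (\<exists>w\<in>period_lattice R. u + (fst x + rotation (snd x), snd x) - w \<in> B)" for u
  proof
    assume "\<exists>w\<in>period_lattice R. u + billiard_map R x - w \<in> B"
    then obtain w where "w \<in> period_lattice R" "u + (fst x + rotation (snd x), snd x) - (v + w) \<in> B"
      unfolding v(2) by (auto simp: diff_diff_eq add_diff_eq)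
    then show "\<exists>w\<in>period_lattice R. u + (fst x + rotation (snd x), snd x) - w \<in> B"
      using period_lattice_add[OF v(1)] by blast
  next
    assume "\<exists>w\<in>period_lattice R. u + (fst x + rotation (snd x), snd x) - w \<in> B"
    then obtain w where w: "w \<in> period_lattice R" "u + (fst x + rotation (snd x), snd x) - w \<in> B" by blast
    have "u + billiard_map R x - (w + - v) = u + (fst x + rotation (snd x), snd x) - w"
      unfolding v(2) by (simp add: algebra_simps)
    then show "\<exists>w\<in>period_lattice R. u + billiard_map R x - w \<in> B"
      using w period_lattice_add[OF w(1) period_lattice_uminus[OF v(1)]] by metis
  qed
  then show ?thesis by (simp add: perturbation_def)
qed

lemma ex_lattice_measurable:
  assumes [measurable]: "B \<in> sets borel" "f \<in> borel_measurable N"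
  shows "{x \<in> space N. \<exists>w\<in>period_lattice R. f x - w \<in> B} \<in> sets N"
  using countable_period_lattice by measurable

lemma random_billiard_kernel_measurable:
  assumes "random_billiard_kernel R \<nu> P"
  shows "P \<in> m \<rightarrow>\<^sub>M prob_algebra m"
proof -
  have "prob_algebra m = prob_algebra (collision_borel R)"
    unfolding prob_algebra_def using subprob_algebra_cong[OF sets_collision_borel] by simp
  then show ?thesis
    using assms measurable_cong_sets[OF sets_collision_borel refl] by (auto simp: random_billiard_kernel_def)
qed

text \<open>Fubini fixes the noise first; for each \<open>u\<close> the motion is a sheared
  translation modulo the lattice, and \<open>emeasure_shear_mod_lattice_le\<close> gives one
  inequality. Applied to the complement as well, it becomes an equality because both sides have
  total mass 1.\<close>

lemma collision_measure_invariant: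
  assumes \<nu>: "prob_space \<nu>" "sets \<nu> = sets borel" and P: "random_billiard_kernel R \<nu> P"
    and B: "B \<in> sets m"
  shows "(\<integral>\<^sup>+x. emeasure (P x) B \<partial>m) = emeasure m B"
proof -
  interpret m: prob_space m by (rule prob_space_collision_measure)
  interpret \<nu>: prob_space \<nu> by (rule \<nu>(1))
  interpret pair: pair_sigma_finite lborel \<nu> ..
  note kernel = random_billiard_kernel_measurable[OF P]
  note [measurable] = measurable_prob_algebraD[OF kernel]
  have le: "(\<integral>\<^sup>+x. emeasure (P x) B \<partial>m) \<le> emeasure m B" if B: "B \<in> sets m" for B
  proof -
    have [measurable]: "B \<in> sets borel" and "B \<subseteq> M" using B by (auto simp: sets_collision_measure_iff)
    define G where "G = {z \<in> space (lborel \<Otimes>\<^sub>M \<nu>). \<exists>w\<in>period_lattice R.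
      snd z + (fst (fst z) + rotation (snd (fst z)), snd (fst z)) - w \<in> B}"
    have \<nu>_borel: "lborel \<Otimes>\<^sub>M \<nu> \<rightarrow>\<^sub>M borel = borel \<Otimes>\<^sub>M borel \<rightarrow>\<^sub>M (borel :: (real \<times> real) measure)"
      by (rule measurable_cong_sets) (simp_all add: \<nu>(2) cong: sets_pair_measure_cong)
    have "(\<lambda>z. snd z + (fst (fst z) + rotation (snd (fst z)), snd (fst z))) \<in> lborel \<Otimes>\<^sub>M \<nu> \<rightarrow>\<^sub>M (borel :: (real \<times> real) measure)"
    proof -
      have "(\<lambda>z. snd z + (fst (fst z) + rotation (snd (fst z)), snd (fst z)))
          \<in> borel \<Otimes>\<^sub>M borel \<rightarrow>\<^sub>M (borel :: (real \<times> real) measure)"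
        by (intro borel_measurable_add borel_measurable_Pair) measurable
      then show ?thesis unfolding \<nu>_borel .
    qed
    then have G[measurable]: "G \<in> sets (lborel \<Otimes>\<^sub>M \<nu>)"
      unfolding G_def by (rule ex_lattice_measurable[rotated]) simp
    have space_\<nu>: "space \<nu> = UNIV" using sets_eq_imp_space_eq[OF \<nu>(2)] by simp
    have "(\<integral>\<^sup>+x. emeasure (P x) B \<partial>m) = (\<integral>\<^sup>+x. emeasure \<nu> (Pair x -` G) \<partial>m)"
    proof (rule nn_integral_cong_AE)
      have "AE x in m. \<forall>B\<in>sets (collision_borel R). emeasure (P x) B = perturbation R \<nu> (billiard_map R x) B"
        using P by (simp add: random_billiard_kernel_def)
      moreover have "AE x in m. \<bar>snd x\<bar> < 1"
        unfolding AE_collision_measure using AE_snd_neq[of 1] AE_snd_neq[of "-1"]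
        by eventually_elim (auto simp: collision_space_def)
      ultimately show "AE x in m. emeasure (P x) B = emeasure \<nu> (Pair x -` G)"
      proof eventually_elim
        case (elim x)
        have "Pair x -` G = {u. \<exists>w\<in>period_lattice R. u + (fst x + rotation (snd x), snd x) - w \<in> B}"
          by (auto simp: G_def space_pair_measure space_\<nu>)
        with elim B show ?case
          by (simp add: sets_collision_borel perturbation_billiard_map)
      qed
    qed
    also have "\<dots> = ennreal (1 / (2 * L)) * (\<integral>\<^sup>+x. emeasure \<nu> (Pair x -` G) * indicator M x \<partial>lborel)"
    proof (rule nn_integral_collision_measure[OF measurable_collision_measure])
      show "(\<lambda>x. emeasure \<nu> (Pair x -` G)) \<in> borel_measurable borel"
        using \<nu>.measurable_emeasure_Pair[OF G] by simp
    qed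
    also have "(\<integral>\<^sup>+x. emeasure \<nu> (Pair x -` G) * indicator M x \<partial>lborel) =
        (\<integral>\<^sup>+x. \<integral>\<^sup>+u. indicator G (x, u) * indicator M x \<partial>\<nu> \<partial>lborel)"
    proof (rule nn_integral_cong)
      fix x :: "real \<times> real"
      have "Pair x -` G \<in> sets \<nu>" by (rule sets_Pair1[OF G])
      then show "emeasure \<nu> (Pair x -` G) * indicator M x = (\<integral>\<^sup>+u. indicator G (x, u) * indicator M x \<partial>\<nu>)"
        by (simp add: nn_integral_multc indicator_vimage[symmetric] flip: nn_integral_indicator)
    qed
    also have "\<dots> = (\<integral>\<^sup>+u. \<integral>\<^sup>+x. indicator G (x, u) * indicator M x \<partial>lborel \<partial>\<nu>)"
      by (rule pair.Fubini'[symmetric]) measurable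
    also have "\<dots> \<le> (\<integral>\<^sup>+u. emeasure lborel B \<partial>\<nu>)"
    proof (rule nn_integral_mono)
      fix u :: "real \<times> real"
      let ?E = "{x \<in> M. \<exists>w\<in>period_lattice R. (fst x + (rotation (snd x) + fst u), snd x + snd u) - w \<in> B}"
      have "(\<lambda>x. indicator G (x, u) * indicator M x) = (indicator ?E :: _ \<Rightarrow> ennreal)"
        by (auto simp: G_def space_pair_measure space_\<nu> fun_eq_iff indicator_def plus_prod_def add_ac)
      moreover have "?E \<in> sets lborel"
      proof -
        have "{x \<in> space borel. \<exists>w\<in>period_lattice R. (fst x + (rotation (snd x) + fst u), snd x + snd u) - w \<in> B} \<in> sets borel"
          by (rule ex_lattice_measurable[OF \<open>B \<in> sets borel\<close>], intro borel_measurable_Pair) measurable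
        moreover have "?E = {x \<in> space borel. \<exists>w\<in>period_lattice R. (fst x + (rotation (snd x) + fst u), snd x + snd u) - w \<in> B} \<inter> M"
          by auto
        ultimately show ?thesis by (simp only: sets_lborel) (intro sets.Int collision_space_borel)
      qed
      moreover have "emeasure lborel ?E \<le> emeasure lborel B"
        by (rule emeasure_shear_mod_lattice_le) measurable
      ultimately show "(\<integral>\<^sup>+x. indicator G (x, u) * indicator M x \<partial>lborel) \<le> emeasure lborel B"
        by simp
    qed
    also have "\<dots> = emeasure lborel B" by (simp add: \<nu>.emeasure_space_1)
    finally show ?thesis
      using B by (simp add: emeasure_collision_measure mult_left_mono)
  qed
  show ?thesis
  proof (rule antisym[OF le[OF B]])
    have P_prob: "prob_space (P x)" "sets (P x) = sets m" if "x \<in> M" for x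
      using measurable_space[OF kernel, of x] that by (auto simp: space_prob_algebra space_collision_measure)
    have [measurable]: "B \<in> sets m" by (rule B)
    have "1 = (\<integral>\<^sup>+x. emeasure (P x) B + emeasure (P x) (space m - B) \<partial>m)"
    proof -
      have "emeasure (P x) B + emeasure (P x) (space m - B) = 1" if "x \<in> space m" for x
      proof -
        have x: "x \<in> M" using that by (simp add: space_collision_measure)
        interpret Px: prob_space "P x" by (rule P_prob[OF x])
        have sp: "space (P x) = space m" using sets_eq_imp_space_eq[OF P_prob(2)[OF x]] .
        have "emeasure (P x) B + emeasure (P x) (space m - B) = emeasure (P x) (space m)"
          using B sets.sets_into_space[OF B] P_prob(2)[OF x] by (subst plus_emeasure) (auto simp: Un_absorb1)
        then show ?thesis using Px.emeasure_space_1 sp by simp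
      qed
      then have "(\<integral>\<^sup>+x. emeasure (P x) B + emeasure (P x) (space m - B) \<partial>m) = (\<integral>\<^sup>+x. 1 \<partial>m)"
        by (intro nn_integral_cong) simp
      then show ?thesis by (simp add: m.emeasure_space_1)
    qed
    also have "\<dots> = (\<integral>\<^sup>+x. emeasure (P x) B \<partial>m) + (\<integral>\<^sup>+x. emeasure (P x) (space m - B) \<partial>m)"
      by (rule nn_integral_add) measurable
    also have "\<dots> \<le> (\<integral>\<^sup>+x. emeasure (P x) B \<partial>m) + emeasure m (space m - B)"
      by (intro add_left_mono le) simp
    finally have "emeasure m B + emeasure m (space m - B) \<le> (\<integral>\<^sup>+x. emeasure (P x) B \<partial>m) + emeasure m (space m - B)"
      using sets.sets_into_space[OF B] by (subst plus_emeasure) (auto simp: Un_absorb1 m.emeasure_space_1)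
    then show "emeasure m B \<le> (\<integral>\<^sup>+x. emeasure (P x) B \<partial>m)"
      by (metis add.commute ennreal_add_left_cancel_le m.emeasure_finite infinity_ennreal_def)
  qed
qed

text \<open>Otherwise almost all of \<open>M\<close> would be sent into \<open>M - V\<close>, and
  the preimage bound would make \<open>V\<close> null. \<open>Q\<close> is an arbitrary predicate,
  so the measurable set in the argument is built from \<open>V\<close>.\<close>

lemma billiard_map_visits_open:
  assumes Q: "AE x in m. Q (billiard_map R x)" and V: "open V" "V \<subseteq> M" "V \<noteq> {}"
  shows "\<exists>z\<in>V. Q z"
proof (rule ccontr)
  assume "\<not> (\<exists>z\<in>V. Q z)"
  then have notQ: "\<And>z. Q z \<Longrightarrow> z \<notin> V" by blast
  have V_borel: "V \<in> sets borel" using V(1) by simp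
  let ?E = "{x \<in> M. \<exists>w\<in>period_lattice R. (fst x + rotation (snd x), snd x + 0) - w \<in> M - V}"
  have E: "?E \<in> sets borel"
  proof -
    have "{x \<in> space borel. \<exists>w\<in>period_lattice R. (fst x + rotation (snd x), snd x + 0) - w \<in> M - V} \<in> sets borel"
      by (rule ex_lattice_measurable[OF sets.Diff[OF collision_space_borel V_borel]], intro borel_measurable_Pair) measurable
    moreover have "?E = {x \<in> space borel. \<exists>w\<in>period_lattice R. (fst x + rotation (snd x), snd x + 0) - w \<in> M - V} \<inter> M"
      by auto
    ultimately show ?thesis by (simp only:) (intro sets.Int collision_space_borel)
  qed
  have "AE x in lborel. x \<in> M \<longrightarrow> x \<in> ?E"
    using Q[unfolded AE_collision_measure] AE_snd_neq[of 1] AE_snd_neq[of "-1"]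
  proof eventually_elim
    case (elim x)
    show ?case
    proof
      assume x: "x \<in> M"
      then have s: "\<bar>snd x\<bar> < 1" using elim by (auto simp: collision_space_def)
      obtain w where w: "w \<in> period_lattice R" "billiard_map R x = (fst x + rotation (snd x), snd x) - w"
        using billiard_map_mod_lattice[OF s] .
      have "billiard_map R x \<in> M - V"
        using billiard_map_in_collision_space[OF x] notQ elim(1) x by blast
      with x w show "x \<in> ?E" by auto
    qed
  qed
  then have "emeasure lborel M \<le> emeasure lborel ?E"
    using E by (intro emeasure_mono_AE) (auto elim: eventually_mono)
  also have "\<dots> \<le> emeasure lborel (M - V)"
    by (rule emeasure_shear_mod_lattice_le[OF sets.Diff[OF collision_space_borel V_borel] rotation_measurable])
  also have "\<dots> + emeasure lborel V = emeasure lborel M"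
    using V V_borel by (subst plus_emeasure) (auto simp: Un_absorb2)
  finally have "emeasure lborel M + emeasure lborel V \<le> emeasure lborel M + 0"
    by (simp add: add_right_mono)
  then have "emeasure lborel V = 0"
    by (subst (asm) ennreal_add_left_cancel_le) (simp add: emeasure_collision_space)
  then have "V \<in> null_sets lborel" using V_borel by (auto simp: null_sets_def)
  then have "AE x in lborel. x \<notin> V" by (rule AE_not_in)
  then show False using open_not_AE_empty V by blast
qed

lemma random_billiard_irreducible:
  fixes h :: "real \<times> real \<Rightarrow> real"
  assumes \<epsilon>: "\<epsilon> > 0" and \<rho>[measurable]: "\<rho> \<in> borel_measurable borel"
    and \<nu>: "\<nu> = density lborel (\<lambda>u. ennreal (\<rho> u))"
    and pos: "\<And>u. u \<in> ball (0, 0) \<epsilon> \<Longrightarrow> \<rho> u > 0"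
    and P: "random_billiard_kernel R \<nu> P"
    and h: "h \<in> borel_measurable m" and AE_h: "AE x in m. AE y in P x. h y = h x"
  shows "\<exists>c. AE x in m. h x = c"
proof -
  \<comment> \<open>The interior is open and connected; the seam and the tangential lines left out
    are null and are restored at the end.\<close>
  define U where "U = {0<..<L} \<times> {-1<..<1::real}"
  have U: "open U" "connected U" "U \<subseteq> M"
    unfolding U_def by (auto intro!: open_Times convex_connected convex_Times simp: collision_space_def)
  have level_m: "{y \<in> M. h y \<noteq> c} \<in> sets m" for c
  proof -
    have "{y \<in> space m. h y \<noteq> c} \<in> sets m" using h by measurable
    then show ?thesis by (simp add: space_collision_measure)
  qed
  then have level: "{y \<in> M. h y \<noteq> c} \<in> sets borel" for c
    by (simp add: sets_collision_measure_iff)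
  have good: "AE x in m. \<exists>c. AE y in lborel. y \<in> ball (billiard_map R x) \<epsilon> \<inter> M \<longrightarrow> h y = c"
  proof -
    have "AE x in m. \<forall>B\<in>sets (collision_borel R). emeasure (P x) B = perturbation R \<nu> (billiard_map R x) B"
      using P by (simp add: random_billiard_kernel_def)
    with AE_h AE_space show ?thesis
    proof eventually_elim
      case (elim x)
      define z where "z = billiard_map R x"
      let ?B = "{y \<in> M. h y \<noteq> h x}"
      have sets_Px: "sets (P x) = sets m"
        using measurable_space[OF random_billiard_kernel_measurable[OF P] elim(2)] by (simp add: space_prob_algebra)
      have space_Px: "space (P x) = M"
        using sets_eq_imp_space_eq[OF sets_Px] by (simp add: space_collision_measure)
      have B: "?B \<in> sets (P x)" using level_m sets_Px by simp
      have "AE y in P x. y \<notin> ?B" using elim(1) by eventually_elim simp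
      then have "emeasure (P x) ?B = 0" using AE_iff_null_sets[OF B] by auto
      then have zero: "emeasure \<nu> {u. \<exists>w\<in>period_lattice R. u + z - w \<in> ?B} = 0"
        using elim(3) level_m by (simp add: sets_collision_borel perturbation_def z_def)
      have "{u \<in> space \<nu>. \<exists>w\<in>period_lattice R. u + z - w \<in> ?B} \<in> sets \<nu>"
        by (rule ex_lattice_measurable[OF level]) (simp add: \<nu>)
      then have "{u. \<exists>w\<in>period_lattice R. u + z - w \<in> ?B} \<in> null_sets \<nu>"
        using zero by (simp add: \<nu> null_sets_def)
      then have "AE u in \<nu>. \<not> (\<exists>w\<in>period_lattice R. u + z - w \<in> ?B)"
        using AE_not_in by fastforce
      \<comment> \<open>The zero lattice vector selects the unwrapped translate of the noise, whose
        density is positive on the ball around \<open>z\<close>.\<close>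
      moreover have "0 \<in> period_lattice R"
        unfolding period_lattice_def zero_prod_def by (force intro: exI[of _ 0])
      ultimately have "AE u in \<nu>. u + z \<notin> ?B"
        by (auto elim!: eventually_mono)
      then have "AE u in lborel. 0 < \<rho> u \<longrightarrow> u + z \<notin> ?B"
        unfolding \<nu> by (subst (asm) AE_density) (simp_all add: ennreal_less_zero_iff)
      then have "AE u in lborel. u \<in> ball 0 \<epsilon> \<longrightarrow> u + z \<notin> ?B"
        by eventually_elim (use pos in \<open>auto simp: zero_prod_def\<close>)
      then have "AE u in distr lborel borel ((+) (- z)). u \<in> ball 0 \<epsilon> \<longrightarrow> u + z \<notin> ?B"
        unfolding lborel_distr_plus .
      then have "AE y in lborel. - z + y \<in> ball 0 \<epsilon> \<longrightarrow> - z + y + z \<notin> ?B"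
        by (rule AE_distrD[rotated]) simp
      then have "AE y in lborel. y \<in> ball z \<epsilon> \<inter> M \<longrightarrow> h y = h x"
        by eventually_elim (auto simp: dist_norm norm_minus_commute)
      then show ?case unfolding z_def by blast
    qed
  qed
  have "\<exists>c. AE y in lborel. y \<in> U \<longrightarrow> h y = c"
  proof (rule connected_AE_locally_const[OF U(1,2)])
    \<comment> \<open>An arbitrary \<open>z\<close> need not be a typical image, but one lies within
      half the radius, and its full ball covers the half ball around \<open>z\<close>.\<close>
    show "\<epsilon> / 2 > 0" using \<epsilon> by simp
    show "{y \<in> U. h y \<noteq> c} \<in> sets borel" for c
    proof -
      have "{y \<in> U. h y \<noteq> c} = {y \<in> M. h y \<noteq> c} \<inter> U" using U(3) by auto
      then show ?thesis using level[of c] U(1) by simp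
    qed
    fix z assume z: "z \<in> U"
    obtain g where g: "g \<in> ball z (\<epsilon> / 2) \<inter> U" "\<exists>c. AE y in lborel. y \<in> ball g \<epsilon> \<inter> M \<longrightarrow> h y = c"
    proof -
      have "open (ball z (\<epsilon> / 2) \<inter> U)" "ball z (\<epsilon> / 2) \<inter> U \<subseteq> M" "z \<in> ball z (\<epsilon> / 2) \<inter> U"
        using U z \<epsilon> by auto
      from billiard_map_visits_open[OF good this(1,2)] this(3) that show ?thesis by blast
    qed
    have sub: "ball z (\<epsilon> / 2) \<subseteq> ball g \<epsilon>"
    proof
      fix y assume "y \<in> ball z (\<epsilon> / 2)"
      with g(1) show "y \<in> ball g \<epsilon>"
        using dist_triangle[of g y z] by (simp add: dist_commute)
    qed
    from g(2) obtain c where "AE y in lborel. y \<in> ball g \<epsilon> \<inter> M \<longrightarrow> h y = c" by blast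
    then have "AE y in lborel. y \<in> ball z (\<epsilon> / 2) \<inter> U \<longrightarrow> h y = c"
      by eventually_elim (use sub U(3) in blast)
    then show "\<exists>c. AE y in lborel. y \<in> ball z (\<epsilon> / 2) \<inter> U \<longrightarrow> h y = c" by blast
  qed
  then obtain c where c: "AE y in lborel. y \<in> U \<longrightarrow> h y = c" by blast
  have "AE x in m. h x = c"
    unfolding AE_collision_measure using c AE_fst_neq[of 0] AE_snd_neq[of 1] AE_snd_neq[of "-1"]
    by eventually_elim (auto simp: U_def collision_space_def)
  then show ?thesis by blast
qed

end

section \<open>Lyapunov exponents\<close>

text \<open>Lipschitz dependence on the off-diagonal entry serves twice: it gives continuity, hence
  measurability, and with \<open>b = 0\<close> the linear bound on the norm.\<close>

lemma onorm_transvection_diff: "onorm ((*v) (transvection a)) \<le> onorm ((*v) (transvection b)) + \<bar>a - b\<bar>"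
proof (rule onorm_le)
  fix v :: "real^2"
  have "transvection a *v v = transvection b *v v + ((a - b) * v$2) *\<^sub>R axis 1 1"
    by (simp add: vec_eq_iff forall_2 transvection_def matrix_vector_mult_def sum_2 axis_def algebra_simps)
  also have "norm \<dots> \<le> norm (transvection b *v v) + norm (((a - b) * v$2) *\<^sub>R axis 1 1 :: real^2)"
    by (rule norm_triangle_ineq)
  also have "norm (((a - b) * v$2) *\<^sub>R axis 1 1 :: real^2) \<le> \<bar>a - b\<bar> * norm v"
    using component_le_norm_cart[of v 2] by (simp add: abs_mult mult_left_mono)
  also have "norm (transvection b *v v) \<le> onorm ((*v) (transvection b)) * norm v"
    by (rule onorm) simp
  finally show "norm (transvection a *v v) \<le> (onorm ((*v) (transvection b)) + \<bar>a - b\<bar>) * norm v"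
    by (simp add: distrib_right)
qed

text \<open>The first basis vector is fixed. The logarithm of the norm is thus nonnegative, which
  gives the lower bound for the exponent.\<close>

lemma onorm_transvection_ge: "1 \<le> onorm ((*v) (transvection a))"
proof -
  have "transvection a *v axis 1 1 = axis 1 1"
    by (simp add: vec_eq_iff forall_2 transvection_def matrix_vector_mult_def sum_2 axis_def)
  then show ?thesis
    using onorm[of "(*v) (transvection a)" "axis 1 1"] by simp
qed

lemma transvection_mult: "transvection a ** transvection b = transvection (a + b)"
  by (simp add: transvection_def vec_eq_iff forall_2 matrix_matrix_mult_def sum_2)

lemma det_transvection: "det (transvection a) = 1"
  by (simp add: transvection_def det_2)

lemma onorm_transvection_le: "onorm ((*v) (transvection a)) \<le> 1 + \<bar>a\<bar>"
proof -
  have "(*v) (mat 1 :: real^2^2) = (\<lambda>v. v)" by auto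
  then have "onorm ((*v) (transvection 0)) \<le> 1"
    unfolding transvection_0 by (simp add: onorm_id_le)
  then show ?thesis using onorm_transvection_diff[of a 0] by simp
qed

lemma continuous_on_onorm_transvection: "continuous_on UNIV (\<lambda>a. onorm ((*v) (transvection a)))"
proof (rule continuous_on_iff[THEN iffD2], intro ballI allI impI)
  fix a e :: real assume "0 < e"
  have "dist (onorm ((*v) (transvection b))) (onorm ((*v) (transvection a))) < e" if "dist b a < e" for b
    using onorm_transvection_diff[of a b] onorm_transvection_diff[of b a] that by (simp add: dist_real_def)
  then show "\<exists>d>0. \<forall>b\<in>UNIV. dist b a < d \<longrightarrow> dist (onorm ((*v) (transvection b))) (onorm ((*v) (transvection a))) < e"
    using \<open>0 < e\<close> by blast
qed

lemma ln_onorm_transvection_measurable[measurable]: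
  "(\<lambda>a. ln (onorm ((*v) (transvection a)))) \<in> borel_measurable borel"
  using borel_measurable_continuous_onI[OF continuous_on_onorm_transvection] by measurable

lemma ln_onorm_transvection_nonneg: "0 \<le> ln (onorm ((*v) (transvection a)))"
  using onorm_transvection_ge by simp

text \<open>This is the tangent line of the concave logarithm at the free parameter
  \<open>k\<close>; choosing \<open>k\<close> as the number of steps later replaces an appeal to
  Jensen.\<close>

lemma ln_onorm_transvection_le:
  assumes "0 < k"
  shows "ln (onorm ((*v) (transvection a))) \<le> ln k + (1 + \<bar>a\<bar>) / k - 1"
proof -
  have "0 < onorm ((*v) (transvection a))" using onorm_transvection_ge[of a] by linarith
  then have "ln (onorm ((*v) (transvection a))) \<le> ln (1 + \<bar>a\<bar>)"
    using onorm_transvection_le[of a] by simp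
  also have "\<dots> = ln k + ln ((1 + \<bar>a\<bar>) / k)"
  proof -
    have "1 + \<bar>a\<bar> \<noteq> 0" by linarith
    then show ?thesis using assms by (simp add: ln_div)
  qed
  also have "ln ((1 + \<bar>a\<bar>) / k) \<le> (1 + \<bar>a\<bar>) / k - 1"
    using assms by (intro ln_le_minus_one) auto
  finally show ?thesis by simp
qed

text \<open>The antiderivative \<open>arcsin\<close> stays continuous at the endpoints, where its
  derivative blows up. This makes the tangential singularity of the shear integrable.\<close>

lemma nn_integral_inverse_sqrt:
  "(\<integral>\<^sup>+s. ennreal (indicator {-1..1} s * inverse (sqrt (1 - s\<^sup>2))) \<partial>lborel) = ennreal pi"
proof (rule nn_integral_has_integral_lborel)
  have "((\<lambda>s. inverse (sqrt (1 - s\<^sup>2))) has_integral arcsin 1 - arcsin (-1)) {-1..1::real}"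
  proof (rule fundamental_theorem_of_calculus_interior)
    show "(arcsin has_vector_derivative inverse (sqrt (1 - s\<^sup>2))) (at s)" if "s \<in> {-1<..<1}" for s :: real
      using that DERIV_arcsin[of s] by (simp add: has_real_derivative_iff_has_vector_derivative)
  qed (auto intro!: continuous_intros)
  then have "((\<lambda>s. if s \<in> {-1..1} then inverse (sqrt (1 - s\<^sup>2)) else 0) has_integral pi) UNIV"
    by (subst has_integral_restrict_UNIV) simp
  also have "(\<lambda>s. if s \<in> {-1..1} then inverse (sqrt (1 - s\<^sup>2)) else 0) =
      (\<lambda>s. indicator {-1..1} s * inverse (sqrt (1 - s\<^sup>2)) :: real)"
    by auto
  finally show "((\<lambda>s. indicator {-1..1} s * inverse (sqrt (1 - s\<^sup>2))) has_integral pi) UNIV" .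
  show "0 \<le> indicator {-1..1} s * inverse (sqrt (1 - s\<^sup>2))" for s :: real
  proof (cases "s \<in> {-1..1}")
    case True
    then have "s\<^sup>2 \<le> 1" by (auto simp: abs_square_le_1 abs_le_iff)
    then show ?thesis by simp
  qed simp
qed measurable

context circular_billiard
begin

section \<open>The cocycle along the process\<close>

lemma shear_at_measurable[measurable]: "shear_at \<in> borel_measurable borel"
proof -
  have "{x. (fst x + rotation (snd x)) / L \<in> \<int>} = {x \<in> space borel. frac ((fst x + rotation (snd x)) / L) = 0}"
    by simp
  also have "\<dots> \<in> sets borel" unfolding frac_def by measurable
  finally have [measurable]: "Measurable.pred borel (\<lambda>x. (fst x + rotation (snd x)) / L \<in> \<int>)"
    by (simp add: pred_def)
  show ?thesis unfolding shear_at_def[abs_def] regular_def shear_def by measurable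
qed

lemma shear_at_integrable: "integrable m shear_at"
proof (rule integrableI_bounded)
  show "shear_at \<in> borel_measurable m" by (rule measurable_collision_measure) measurable
  define g where "g s = indicator {-1..1} s * inverse (sqrt (1 - s\<^sup>2))" for s :: real
  have g_nonneg: "0 \<le> g s" for s
  proof (cases "s \<in> {-1..1}")
    case True
    then have "s\<^sup>2 \<le> 1" by (auto simp: abs_square_le_1 abs_le_iff)
    then show ?thesis by (simp add: g_def)
  qed (simp add: g_def)
  have [measurable]: "g \<in> borel_measurable borel" unfolding g_def by measurable
  have le: "ennreal (norm (shear_at x)) * indicator M x \<le> indicator {0..<L} (fst x) * (ennreal (2 * R) * ennreal (g (snd x)))" for x
  proof (cases "x \<in> M \<and> regular x")
    case True
    then have "\<bar>snd x\<bar> < 1" "fst x \<in> {0..<L}" by (auto simp: regular_def collision_space_def)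
    moreover from this have "(snd x)\<^sup>2 \<le> 1" "snd x \<in> {-1..1}" by (auto simp: abs_square_le_1)
    ultimately have "norm (shear_at x) = 2 * R * g (snd x)"
      using True R_pos by (simp add: shear_at_def shear_def g_def field_simps)
    with True R_pos g_nonneg \<open>fst x \<in> {0..<L}\<close> show ?thesis
      by (simp add: ennreal_mult)
  next
    case False
    then show ?thesis by (auto simp: shear_at_def split: split_indicator)
  qed
  have "(\<integral>\<^sup>+x. ennreal (norm (shear_at x)) * indicator M x \<partial>lborel) \<le>
      (\<integral>\<^sup>+x. indicator {0..<L} (fst x) * (ennreal (2 * R) * ennreal (g (snd x))) \<partial>lborel)"
    by (intro nn_integral_mono le)
  also have "\<dots> = (\<integral>\<^sup>+s. \<integral>\<^sup>+r. indicator {0..<L} r * (ennreal (2 * R) * ennreal (g s)) \<partial>lborel \<partial>lborel)"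
    unfolding lborel_prod[symmetric] by (subst lborel_pair.nn_integral_snd[symmetric]) simp_all
  also have "\<dots> = (\<integral>\<^sup>+s. (ennreal L * ennreal (2 * R)) * ennreal (g s) \<partial>lborel)"
    using perimeter_pos by (simp add: nn_integral_multc mult.assoc)
  also have "\<dots> = (ennreal L * ennreal (2 * R)) * ennreal pi"
    using nn_integral_inverse_sqrt by (subst nn_integral_cmult) (simp_all add: g_def)
  finally have "(\<integral>\<^sup>+x. ennreal (norm (shear_at x)) * indicator M x \<partial>lborel) < \<infinity>"
    using le_less_trans by (fastforce simp: ennreal_mult_less_top)
  moreover have "(\<integral>\<^sup>+x. ennreal (norm (shear_at x)) \<partial>m) =
      ennreal (1 / (2 * L)) * (\<integral>\<^sup>+x. ennreal (norm (shear_at x)) * indicator M x \<partial>lborel)"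
    by (intro nn_integral_collision_measure measurable_collision_measure) measurable
  ultimately show "(\<integral>\<^sup>+x. ennreal (norm (shear_at x)) \<partial>m) < \<infinity>"
    by (simp add: ennreal_mult_less_top)
qed

lemma stationary_chain_random_billiard:
  assumes "prob_space \<nu>" "sets \<nu> = sets borel" "random_billiard_kernel R \<nu> P"
  shows "stationary_chain m P"
proof -
  interpret prob_space m by (rule prob_space_collision_measure)
  show ?thesis
    by unfold_locales
      (rule random_billiard_kernel_measurable[OF assms(3)], rule collision_measure_invariant[OF assms])
qed

lemma cocycle_billiard_map:
  assumes "\<And>k. \<omega> k \<in> M"
  shows "cocycle (jacobian_matrix (billiard_map R)) n \<omega> = transvection (\<Sum>k<n. shear_at (\<omega> k))"
  using assms by (induction n) (simp_all add: transvection_0 jacobian_billiard_map transvection_mult add.commute)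

lemma lyapunov_exponents_zero:
  assumes "stationary_chain m P"
  shows "lyapunov_exponents (markov_law m P) (jacobian_matrix (billiard_map R)) 0 0"
proof -
  interpret stationary_chain m P by (rule assms)
  interpret Q: prob_space path_law by (rule prob_space_path_law)
  define Z where "Z n \<omega> = (\<Sum>k<n. shear_at (\<omega> k))" for n :: nat and \<omega> :: "nat \<Rightarrow> real \<times> real"
  define X where "X n \<omega> = ln (onorm ((*v) (cocycle (jacobian_matrix (billiard_map R)) n \<omega>)))" for n \<omega>
  define C where "C = (\<integral>x. \<bar>shear_at x\<bar> \<partial>m)"
  have coc: "cocycle (jacobian_matrix (billiard_map R)) n \<omega> = transvection (Z n \<omega>)"
    if "\<omega> \<in> space path_law" for n \<omega>
    unfolding Z_def using that by (intro cocycle_billiard_map) (auto simp: space_PiM space_collision_measure)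
  have shear_m[measurable]: "shear_at \<in> borel_measurable m"
    by (rule measurable_collision_measure) measurable
  have comp[measurable]: "(\<lambda>\<omega>. shear_at (\<omega> k)) \<in> borel_measurable path_law" for k
    by measurable
  have int: "integrable path_law (\<lambda>\<omega>. \<bar>shear_at (\<omega> k)\<bar>)" and int_eq: "(\<integral>\<omega>. \<bar>shear_at (\<omega> k)\<bar> \<partial>path_law) = C" for k
  proof -
    have d: "distr path_law m (\<lambda>\<omega>. \<omega> k) = m" by (rule distr_coordinate)
    have c: "(\<lambda>\<omega>. \<omega> k) \<in> path_law \<rightarrow>\<^sub>M m" by measurable
    have i: "integrable (distr path_law m (\<lambda>\<omega>. \<omega> k)) (\<lambda>x. \<bar>shear_at x\<bar>)"
      unfolding d using shear_at_integrable by (rule integrable_abs)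
    show "integrable path_law (\<lambda>\<omega>. \<bar>shear_at (\<omega> k)\<bar>)"
      by (rule integrable_distr[OF c i])
    show "(\<integral>\<omega>. \<bar>shear_at (\<omega> k)\<bar> \<partial>path_law) = C"
      unfolding C_def by (subst d[symmetric, of], subst integral_distr[OF c]) simp_all
  qed
  have Z_meas[measurable]: "Z n \<in> borel_measurable path_law" for n
    unfolding Z_def by measurable
  \<comment> \<open>This dominating sum has mean exactly \<open>n * C\<close> by stationarity; no
    cancellation between the shears is exploited.\<close>
  define S where "S n \<omega> = (\<Sum>k<n. \<bar>shear_at (\<omega> k)\<bar>)" for n :: nat and \<omega> :: "nat \<Rightarrow> real \<times> real"
  have S_int: "integrable path_law (S n)" for n unfolding S_def using int by (intro Bochner_Integration.integrable_sum)
  have S_eq: "(\<integral>\<omega>. S n \<omega> \<partial>path_law) = real n * C" for n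
    unfolding S_def using int int_eq by (subst Bochner_Integration.integral_sum) simp_all
  have Z_le: "\<bar>Z n \<omega>\<bar> \<le> S n \<omega>" for n \<omega> unfolding Z_def S_def by (rule sum_abs)
  have X_nonneg: "0 \<le> X n \<omega>" if "\<omega> \<in> space path_law" for n \<omega>
    unfolding X_def coc[OF that] by (rule ln_onorm_transvection_nonneg)
  have X_le: "X n \<omega> \<le> ln k + (1 + S n \<omega>) / k - 1" if "\<omega> \<in> space path_law" "0 < k" for n \<omega> k
  proof -
    have "X n \<omega> \<le> ln k + (1 + \<bar>Z n \<omega>\<bar>) / k - 1"
      unfolding X_def coc[OF that(1)] by (rule ln_onorm_transvection_le[OF that(2)])
    also have "(1 + \<bar>Z n \<omega>\<bar>) / k \<le> (1 + S n \<omega>) / k"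
      using that(2) Z_le by (intro divide_right_mono) auto
    finally show ?thesis by simp
  qed
  have X_meas: "X n \<in> borel_measurable path_law" for n
  proof -
    have "(\<lambda>\<omega>. ln (onorm ((*v) (transvection (Z n \<omega>))))) \<in> borel_measurable path_law"
      by (rule measurable_compose[OF Z_meas ln_onorm_transvection_measurable])
    then show ?thesis
      by (subst measurable_cong[where g="\<lambda>\<omega>. ln (onorm ((*v) (transvection (Z n \<omega>))))"]) (simp_all add: X_def coc)
  qed
  have X_int: "integrable path_law (X n)" for n
  proof (rule Bochner_Integration.integrable_bound[OF S_int X_meas])
    show "AE \<omega> in path_law. norm (X n \<omega>) \<le> norm (S n \<omega>)"
    proof (rule AE_I2)
      fix \<omega> assume \<omega>: "\<omega> \<in> space path_law"
      have "0 \<le> S n \<omega>" unfolding S_def by (simp add: sum_nonneg)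
      \<comment> \<open>For \<open>k = 1\<close> the tangent bound reads
        \<open>X n \<omega> \<le> S n \<omega>\<close>.\<close>
      with X_nonneg[OF \<omega>, of n] X_le[OF \<omega>, of 1 n] show "norm (X n \<omega>) \<le> norm (S n \<omega>)" by simp
    qed
  qed
  have lower: "0 \<le> 1 / real n * (\<integral>\<omega>. X n \<omega> \<partial>path_law)" for n
    using X_nonneg by (intro mult_nonneg_nonneg Bochner_Integration.integral_nonneg) auto
  have upper: "1 / real n * (\<integral>\<omega>. X n \<omega> \<partial>path_law) \<le> ln (real n) / real n + (1 / real n) * (1 / real n) + (C - 1) * (1 / real n)"
    if "n \<ge> 1" for n
  proof -
    have n: "0 < real n" using that by simp
    \<comment> \<open>With \<open>k = n\<close> the linear term has mean \<open>C\<close>, so the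
      mean of \<open>X n\<close> exceeds \<open>ln n\<close> by a bounded amount.\<close>
    have "(\<integral>\<omega>. X n \<omega> \<partial>path_law) \<le> (\<integral>\<omega>. (ln (real n) + 1 / real n - 1) + S n \<omega> / real n \<partial>path_law)"
    proof (rule integral_mono[OF X_int])
      show "integrable path_law (\<lambda>\<omega>. (ln (real n) + 1 / real n - 1) + S n \<omega> / real n)"
        using S_int by simp
      show "X n \<omega> \<le> (ln (real n) + 1 / real n - 1) + S n \<omega> / real n" if "\<omega> \<in> space path_law" for \<omega>
        using X_le[OF that n, of n] by (simp add: add_divide_distrib)
    qed
    also have "\<dots> = (ln (real n) + 1 / real n - 1) + C"
      using S_int[of n] S_eq[of n] n Q.prob_space by simp
    finally have "1 / real n * (\<integral>\<omega>. X n \<omega> \<partial>path_law) \<le> 1 / real n * ((ln (real n) + 1 / real n - 1) + C)"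
      using n by (intro mult_left_mono) auto
    then show ?thesis by (simp add: algebra_simps diff_divide_distrib)
  qed
  have lim: "(\<lambda>n. 1 / real n * (\<integral>\<omega>. X n \<omega> \<partial>path_law)) \<longlonglongrightarrow> 0"
  proof (rule tendsto_sandwich[OF always_eventually eventually_sequentiallyI[of 1] tendsto_const])
    have "(\<lambda>n. ln (real n) / real n + (1 / real n) * (1 / real n) + (C - 1) * (1 / real n)) \<longlonglongrightarrow> 0 + 0 * 0 + (C - 1) * 0"
      by (intro tendsto_intros lim_ln_over_n lim_1_over_n)
    then show "(\<lambda>n. ln (real n) / real n + (1 / real n) * (1 / real n) + (C - 1) * (1 / real n)) \<longlonglongrightarrow> 0" by simp
  qed (use lower upper in auto)
  have det: "ln \<bar>det (cocycle (jacobian_matrix (billiard_map R)) n \<omega>)\<bar> = 0" if "\<omega> \<in> space path_law" for n \<omega>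
    by (simp add: coc[OF that] det_transvection)
  have det_int: "integrable path_law (\<lambda>\<omega>. ln \<bar>det (cocycle (jacobian_matrix (billiard_map R)) n \<omega>)\<bar>)" for n
    by (subst Bochner_Integration.integrable_cong[OF refl det]) simp_all
  have det_eq: "(\<integral>\<omega>. ln \<bar>det (cocycle (jacobian_matrix (billiard_map R)) n \<omega>)\<bar> \<partial>path_law) = 0" for n
    by (subst Bochner_Integration.integral_cong[OF refl det]) simp_all
  show ?thesis
    unfolding lyapunov_exponents_def
    using X_int lim det_int by (simp add: X_def[abs_def] det_eq)
qed

end

theorem theorem4p10:
  fixes R \<epsilon> :: real
    and \<rho> :: "real \<times> real \<Rightarrow> real"
    and \<nu> :: "(real \<times> real) measure"
    and P :: "real \<times> real \<Rightarrow> (real \<times> real) measure"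
  assumes "R > 0" and "\<epsilon> > 0"
    and "\<rho> \<in> borel_measurable borel" and "\<And>u. \<rho> u \<ge> 0"
    and "\<nu> = density lborel (\<lambda>u. ennreal (\<rho> u))" and "prob_space \<nu>"
    and "\<And>u. u \<in> ball (0, 0) \<epsilon> \<Longrightarrow> \<rho> u > 0"
    and "random_billiard_kernel R \<nu> P"
  shows "markov_ergodic (collision_measure R) P \<and>
         lyapunov_exponents (markov_law (collision_measure R) P)
           (jacobian_matrix (billiard_map R)) 0 0"
proof
  interpret circular_billiard R by standard (rule assms(1))
  have "sets \<nu> = sets borel" by (simp add: assms(5))
  then have chain: "stationary_chain (collision_measure R) P"
    using assms(6,8) by (intro stationary_chain_random_billiard)
  then interpret stationary_chain "collision_measure R" P .
  show "markov_ergodic (collision_measure R) P"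
    by (rule markov_ergodicI) (rule random_billiard_irreducible[OF assms(2,3,5,7,8)])
  show "lyapunov_exponents (markov_law (collision_measure R) P) (jacobian_matrix (billiard_map R)) 0 0"
    by (rule lyapunov_exponents_zero[OF chain])
qed

end
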